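(* Let $\mathcal{P}(t,x_t,f_t)$ be the optimization program instance (defined in the context) generated at time $t$ for the initial state $x_t$ and with any safe, non-regressive optimization horizon $f_t$ produced by the horizon-computation procedure described in the context. Then: (a) the state $x_t$ is not deadlocked if and only if $\mathcal{P}(t,x_t,f_t)$ is feasible; and (b) if $\mathcal{P}(t,x_t,f_t)$ is feasible, then its operation is recursively feasible.
   Context: Network and trains. A railway network is a graph with finite node set $\mathcal{N}$ and finite edge set $\mathcal{E}=\mathcal{E}^{\mathrm{s}}\cup\mathcal{E}^{\mathrm{d}}$ (single and double tracks). A single track carries at most one train at a time; a double track carries at most one train at a time per direction. Each node $n$ has a set $L_n$ of slots, $|L_n|\ge1$, each holding at most one train at a time. $I$ is a finite set of trains. Each train follows a predetermined path, with no node repeated, to its terminal node; terminal nodes are assumed to have infinite capacity (infinitely many slots). $\tau_{i,e}>0$ denotes the travel time of train $i$ on edge $e$. State. The state at time $t$ is $x_t=(\underline n_i,\underline w_i,\underline l_i)_{i\in I}$: $\underline n_i$ is the most recent node visited by train $i$, $\underline w_i\in[0,1]$ is the fraction already traversed of the first edge of its remaining path ($0$ if the train dwells at a node), and $\underline l_i$ is the slot it occupies if it is currently at a node. $I^{\mathrm{edge}}$ is the set of trains currently transiting an edge and $I^{\mathrm{node}}$ the set of trains currently at a node. The state is a physically admissible state of the system (it respects the slot and track capacities and, for trains in transit, the rule that a train acquires a free slot of the next node before starting over the edge leading to it). The remaining path of train $i$ has nodes $n_i[0]=\underline n_i,n_i[1],\dots,n_i[F_i]$, with $n_i[F_i]$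 its terminal, and edges $e_i[0],\dots,e_i[F_i-1]$, with $e_i[k]$ joining $n_i[k]$ to $n_i[k+1]$. For trains in $I^{\mathrm{edge}}$, $e_i[0]$ is the edge being transited. Put $F=(F_i)_{i\in I}$. A horizon is $f=(f_i)_{i\in I}$ with integers $0\le f_i\le F_i$; under it the path of train $i$ is truncated to $n_i[0],\dots,n_i[f_i]$ and $e_i[0],\dots,e_i[f_i-1]$. Write $k_i[n]$, $k_i[e]$ for the index of a node or edge in the path of train $i$. The program $\mathcal{P}(t,x_t,f)$. Its variables are departure times $y_i[k]\ge0$, relative to time $t$, of train $i$ from node $n_i[k]$ ($0\le k\le f_i-1$), and binary variables $z^{\mathrm{edge}}_{i,j,e}$, $z^{\mathrm{node}}_{i,j,n}$ (equal to $1$ if $i$ transits before $j$ over edge $e$, respectively node $n$, and $0$ if $j$ transits before $i$) and $z^{\mathrm{slot}}_{i,n,l}$ ($1$ if $i$ uses slot $l$ of node $n$). The constraints, with all paths truncated by $f$, are as follows. 1. Sequentiality: $y_i[1]\ge y_i[0]+\tau_{i,e_i[0]}(1-\underline w_i)$, and $y_i[k]\ge y_i[k-1]+\tau_{i,e_i[k-1]}$ for $2\le k\le f_i-1$. 2. Edge conflicts: for each edge $e$ and each pair $i<j$ of trains both having $e$ in their paths (for $e\in\mathcal{E}^{\mathrm{d}}$ only if they traverse $e$ in the same direction), $z^{\mathrm{edge}}_{i,j,e}=1$ implies $y_j[k_j[e]]\ge y_i[k_i[e]]+\tau_{i,e}$, and $z^{\mathrm{edge}}_{i,j,e}=0$ implies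 $y_i[k_i[e]]\ge y_j[k_j[e]]+\tau_{j,e}$. 3. Node conflicts: each train $i$ uses exactly one slot at each node $n$ of its path, $\sum_{l\in L_n}z^{\mathrm{slot}}_{i,n,l}=1$. For each node $n$, slot $l\in L_n$ and pair $i<j$ of trains both having $n$ in their paths, if $z^{\mathrm{slot}}_{i,n,l}=z^{\mathrm{slot}}_{j,n,l}=1$, then $z^{\mathrm{node}}_{i,j,n}=1$ implies $y_j[k_j[n]-1]\ge y_i[k_i[n]]$, and $z^{\mathrm{node}}_{i,j,n}=0$ implies $y_i[k_i[n]-1]\ge y_j[k_j[n]]$. Conventions: the node $n_i[0]$ of a train $i\in I^{\mathrm{edge}}$ has already been left and is disregarded here; a train $i\in I^{\mathrm{node}}$ is already at $n_i[0]$, i.e. $y_i[-1]=-\infty$; and a train does not depart from the last node of its truncated path, i.e. $y_i[f_i]=+\infty$. 4. Initial conditions: $y_i[0]=0$ for $i\in I^{\mathrm{edge}}$; a train $i\in I^{\mathrm{edge}}$ has precedence on $e_i[0]$ over all trains in conflict with it there; a train $i\in I^{\mathrm{node}}$ has precedence at $n_i[0]$ over the trains in conflict with it that are not already there, and $z^{\mathrm{slot}}_{i,n_i[0],\underline l_i}=1$. The objective is to minimize the sum over $i\in I$ of the last departure times $y_i[f_i-1]$ (irrelevant to feasibility). The instance is feasible if its constraints admit a solution. Deadlock. The state $x_t$ is deadlocked if and only if the full-horizon program $\mathcal{P}(t,x_t,F)$ is infeasible. Safe states and horizons. A safe state is a state in which all trains are at nodes and every node $n\in\mathcal{N}$ has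 an unoccupied slot. A horizon $f$ has a safe terminal state if the state in which every train $i$ stands at $n_i[f_i]$ is safe. A horizon $\tilde f$ (at the same or a later time) is non-regressive with respect to a horizon $f$, written $f\le\tilde f$, if for each train the node at which $\tilde f$ terminates is equal to or further along its path than the node at which $f$ terminates. The horizon $f_t$ in the theorem is non-regressive with respect to the current state and to the horizon used at the previous computation, if any. Horizon-computation procedure. (1) Set $f_i\leftarrow1$ for all $i\in I$ (or larger initial values; $f_i\leftarrow 0$ if $F_i=0$). (2) Set $\eta_n\leftarrow|L_n|$ for all $n\in\mathcal{N}$. (3) For every $i\in I$ in turn: while $\eta_{n_i[f_i]}\le1$, set $f_i\leftarrow f_i+1$; then set $\eta_{n_i[f_i]}\leftarrow\eta_{n_i[f_i]}-1$. (4) If $\mathcal{P}(t,x_t,f)$ is feasible, return $f$. Otherwise select some $i\in I$ with $f_i<F_i$, set $f_i\leftarrow f_i+1$ and go to (2); if no such $i$ exists (so $f=F$), the procedure ends with $f=F$. Horizons computed by this procedure are called safe optimization horizons; they have a safe terminal state. Closed-loop operation and recursive feasibility. Let $\Delta t>0$ be the interval between recomputations. Given a feasible solution $(y,z)$ of $\mathcal{P}(t,x_t,f_t)$ (not necessarily optimal), the system is operated by it without disturbances: train $i$ departs from $n_i[k]$ exactly at time $t+y_i[k]$, transits $e_i[k]$ in time $\tau_{i,e_i[k]}$ (the remaining time $(1-\underline w_i)\tau_{i,e_i[0]}$ on an initially partially traversed edge), uses the slots given by $z^{\mathrm{slot}}$, dwells at nodes between stages, and remains at $n_i[f_{i,t}]$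 once it gets there. Let $x_{t+\Delta t}$ be the resulting state. The operation of $\mathcal{P}(t,x_t,f_t)$ is recursively feasible if, for every feasible solution of it and the resulting $x_{t+\Delta t}$, the program $\mathcal{P}(t+\Delta t,x_{t+\Delta t},f_{t+\Delta t})$ is again feasible for every horizon $f_{t+\Delta t}$ with safe terminal state that is non-regressive with respect to $f_t$ (hence, inductively, at all subsequent recomputation times). *)

theory Defs
  imports Complex_Main "HOL-Library.Extended_Nat" "HOL-Library.Extended_Real"
begin

text \<open>Parallel tracks between the same two nodes are allowed, so tracks are abstract objects with a
  set of end nodes. Slot labels only have a meaning relative to their node. The list \<open>route R i\<close>
  contains the nodes and \<open>tracks R i\<close> the edges of the whole predetermined path of train \<open>i\<close>.\<close>

record ('n, 'e, 'l, 'i) railway =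
  nodes :: "'n set"
  single_tracks :: "'e set"
  double_tracks :: "'e set"
  ends :: "'e \<Rightarrow> 'n set"
  slots :: "'n \<Rightarrow> 'l set"
  trains :: "'i set"
  route :: "'i \<Rightarrow> 'n list"
  tracks :: "'i \<Rightarrow> 'e list"
  travel_time :: "'i \<Rightarrow> 'e \<Rightarrow> real"

definition wf_railway :: "('n, 'e, 'l, 'i) railway \<Rightarrow> bool" where
  "wf_railway R \<longleftrightarrow>
     finite (nodes R) \<and> finite (single_tracks R) \<and> finite (double_tracks R) \<and>
     single_tracks R \<inter> double_tracks R = {} \<and>
     (\<forall>e \<in> single_tracks R \<union> double_tracks R. \<exists>u \<in> nodes R. \<exists>v \<in> nodes R. ends R e = {u, v}) \<and>
     (\<forall>n \<in> nodes R. slots R n \<noteq> {}) \<and>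
     finite (trains R) \<and>
     (\<forall>i \<in> trains R.
        route R i \<noteq> [] \<and> distinct (route R i) \<and> set (route R i) \<subseteq> nodes R \<and>
        length (route R i) = Suc (length (tracks R i)) \<and>
        set (tracks R i) \<subseteq> single_tracks R \<union> double_tracks R \<and>
        (\<forall>k < length (tracks R i). ends R (tracks R i ! k) = {route R i ! k, route R i ! Suc k}) \<and>
        infinite (slots R (last (route R i))) \<and>
        (\<forall>e \<in> single_tracks R \<union> double_tracks R. 0 < travel_time R i e))"

text \<open>The slot component is \<open>None\<close> exactly for the trains that are transiting an edge.\<close>

record ('n, 'l, 'i) state =
  last_node :: "'i \<Rightarrow> 'n"
  fraction :: "'i \<Rightarrow> real"
  slot :: "'i \<Rightarrow> 'l option"

definition node_trains :: "('n, 'e, 'l, 'i) railway \<Rightarrow> ('n, 'l, 'i) state \<Rightarrow> 'i set" where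
  "node_trains R x = {i \<in> trains R. slot x i \<noteq> None}"

definition edge_trains :: "('n, 'e, 'l, 'i) railway \<Rightarrow> ('n, 'l, 'i) state \<Rightarrow> 'i set" where
  "edge_trains R x = {i \<in> trains R. slot x i = None}"

definition position :: "('n, 'e, 'l, 'i) railway \<Rightarrow> ('n, 'l, 'i) state \<Rightarrow> 'i \<Rightarrow> nat" where
  "position R x i = (THE k. k < length (route R i) \<and> route R i ! k = last_node x i)"

text \<open>The remaining path: \<open>path_node R x i k\<close> is $n_i[k]$, \<open>path_edge R x i k\<close> is $e_i[k]$ and
  \<open>full_horizon R x i\<close> is $F_i$.\<close>

definition path_node :: "('n, 'e, 'l, 'i) railway \<Rightarrow> ('n, 'l, 'i) state \<Rightarrow> 'i \<Rightarrow> nat \<Rightarrow> 'n" where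
  "path_node R x i k = route R i ! (position R x i + k)"

definition path_edge :: "('n, 'e, 'l, 'i) railway \<Rightarrow> ('n, 'l, 'i) state \<Rightarrow> 'i \<Rightarrow> nat \<Rightarrow> 'e" where
  "path_edge R x i k = tracks R i ! (position R x i + k)"

definition full_horizon :: "('n, 'e, 'l, 'i) railway \<Rightarrow> ('n, 'l, 'i) state \<Rightarrow> 'i \<Rightarrow> nat" where
  "full_horizon R x i = length (tracks R i) - position R x i"

text \<open>Trains \<open>i\<close> and \<open>j\<close> use the same track on the edges with indices \<open>a\<close> and \<open>b\<close> of their remaining
  paths. As both paths traverse the edge between its two distinct ends, they do so in the same
  direction iff they enter it from the same node.\<close>

definition same_track ::
  "('n, 'e, 'l, 'i) railway \<Rightarrow> ('n, 'l, 'i) state \<Rightarrow> 'i \<Rightarrow> nat \<Rightarrow> 'i \<Rightarrow> nat \<Rightarrow> bool" where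
  "same_track R x i a j b \<longleftrightarrow>
     path_edge R x i a = path_edge R x j b \<and>
     (path_edge R x i a \<in> double_tracks R \<longrightarrow> path_node R x i a = path_node R x j b)"

text \<open>A train in transit holds a slot of the next node; the state does not record which one, so
  \<open>s\<close> below extends the recorded slots to all trains.\<close>

definition admissible :: "('n, 'e, 'l, 'i) railway \<Rightarrow> ('n, 'l, 'i) state \<Rightarrow> bool" where
  "admissible R x \<longleftrightarrow>
     (\<forall>i \<in> trains R. last_node x i \<in> set (route R i) \<and> 0 \<le> fraction x i \<and> fraction x i \<le> 1) \<and>
     (\<forall>i \<in> node_trains R x. fraction x i = 0) \<and>
     (\<forall>i \<in> edge_trains R x. 0 < full_horizon R x i) \<and>
     (\<forall>i \<in> edge_trains R x. \<forall>j \<in> edge_trains R x. i \<noteq> j \<longrightarrow> \<not> same_track R x i 0 j 0) \<and>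
     (let held_node = (\<lambda>i. path_node R x i (if i \<in> edge_trains R x then 1 else 0)) in
      \<exists>s. (\<forall>i \<in> node_trains R x. slot x i = Some (s i)) \<and>
          (\<forall>i \<in> trains R. s i \<in> slots R (held_node i)) \<and>
          (\<forall>i \<in> trains R. \<forall>j \<in> trains R.
             i \<noteq> j \<and> held_node i = held_node j \<longrightarrow> s i \<noteq> s j))"

type_synonym 'i horizon = "'i \<Rightarrow> nat"

definition is_horizon ::
  "('n, 'e, 'l, 'i) railway \<Rightarrow> ('n, 'l, 'i) state \<Rightarrow> 'i horizon \<Rightarrow> bool" where
  "is_horizon R x f \<longleftrightarrow> (\<forall>i \<in> trains R. f i \<le> full_horizon R x i)"

text \<open>The departure time \<open>dep v i k\<close> is $y_i[k]$, relative to the time of the state, so that time does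
  not occur in the constraints. Binary variables are represented by truth values; \<open>z_edge\<close> and
  \<open>z_node\<close> are only meaningful for pairs \<open>i < j\<close>.\<close>

record ('n, 'e, 'l, 'i) variables =
  dep :: "'i \<Rightarrow> nat \<Rightarrow> real"
  z_edge :: "'i \<Rightarrow> 'i \<Rightarrow> 'e \<Rightarrow> bool"
  z_node :: "'i \<Rightarrow> 'i \<Rightarrow> 'n \<Rightarrow> bool"
  z_slot :: "'i \<Rightarrow> 'n \<Rightarrow> 'l \<Rightarrow> bool"

definition remaining_time ::
  "('n, 'e, 'l, 'i) railway \<Rightarrow> ('n, 'l, 'i) state \<Rightarrow> 'i \<Rightarrow> nat \<Rightarrow> real" where
  "remaining_time R x i k =
     travel_time R i (path_edge R x i k) * (if k = 0 then 1 - fraction x i else 1)"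

definition visits ::
  "('n, 'e, 'l, 'i) railway \<Rightarrow> ('n, 'l, 'i) state \<Rightarrow> 'i horizon \<Rightarrow> 'i \<Rightarrow> nat \<Rightarrow> bool" where
  "visits R x f i k \<longleftrightarrow> k \<le> f i \<and> (k = 0 \<longrightarrow> i \<in> node_trains R x)"

text \<open>Departure from the node with index \<open>k\<close>, with value $+\infty$ at the last node of the truncated
  path, and departure towards that node, with value $-\infty$ if the train is already there.\<close>

definition dep_from :: "'i horizon \<Rightarrow> ('n, 'e, 'l, 'i) variables \<Rightarrow> 'i \<Rightarrow> nat \<Rightarrow> ereal" where
  "dep_from f v i k = (if k < f i then ereal (dep v i k) else \<infinity>)"

definition dep_towards :: "('n, 'e, 'l, 'i) variables \<Rightarrow> 'i \<Rightarrow> nat \<Rightarrow> ereal" where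
  "dep_towards v i k = (if k = 0 then - \<infinity> else ereal (dep v i (k - 1)))"

definition precedes :: "('i::linorder \<Rightarrow> 'i \<Rightarrow> 'a \<Rightarrow> bool) \<Rightarrow> 'i \<Rightarrow> 'i \<Rightarrow> 'a \<Rightarrow> bool" where
  "precedes z i j a \<longleftrightarrow> (if i < j then z i j a else \<not> z j i a)"

definition sequentiality ::
  "('n, 'e, 'l, 'i) railway \<Rightarrow> ('n, 'l, 'i) state \<Rightarrow> 'i horizon
    \<Rightarrow> ('n, 'e, 'l, 'i) variables \<Rightarrow> bool" where
  "sequentiality R x f v \<longleftrightarrow>
     (\<forall>i \<in> trains R. \<forall>k. 1 \<le> k \<and> k < f i \<longrightarrow>
        dep v i k \<ge> dep v i (k - 1) + remaining_time R x i (k - 1))"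

definition edge_conflicts ::
  "('n, 'e, 'l, 'i::linorder) railway \<Rightarrow> ('n, 'l, 'i) state \<Rightarrow> 'i horizon
    \<Rightarrow> ('n, 'e, 'l, 'i) variables \<Rightarrow> bool" where
  "edge_conflicts R x f v \<longleftrightarrow>
     (\<forall>i \<in> trains R. \<forall>j \<in> trains R. \<forall>a < f i. \<forall>b < f j. \<forall>e.
        i < j \<and> same_track R x i a j b \<and> e = path_edge R x i a \<longrightarrow>
        (z_edge v i j e \<longrightarrow> dep v j b \<ge> dep v i a + travel_time R i e) \<and>
        (\<not> z_edge v i j e \<longrightarrow> dep v i a \<ge> dep v j b + travel_time R j e))"

text \<open>The slot equation is stated as unique existence because slot sets may be infinite.\<close>

definition node_conflicts ::
  "('n, 'e, 'l, 'i::linorder) railway \<Rightarrow> ('n, 'l, 'i) state \<Rightarrow> 'i horizon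
    \<Rightarrow> ('n, 'e, 'l, 'i) variables \<Rightarrow> bool" where
  "node_conflicts R x f v \<longleftrightarrow>
     (\<forall>i \<in> trains R. \<forall>k. visits R x f i k \<longrightarrow>
        (\<exists>!l. l \<in> slots R (path_node R x i k) \<and> z_slot v i (path_node R x i k) l)) \<and>
     (\<forall>i \<in> trains R. \<forall>j \<in> trains R. \<forall>a b. \<forall>n. \<forall>l \<in> slots R n.
        i < j \<and> visits R x f i a \<and> visits R x f j b \<and>
        path_node R x i a = n \<and> path_node R x j b = n \<and>
        z_slot v i n l \<and> z_slot v j n l \<longrightarrow>
        (z_node v i j n \<longrightarrow> dep_towards v j b \<ge> dep_from f v i a) \<and>
        (\<not> z_node v i j n \<longrightarrow> dep_towards v i a \<ge> dep_from f v j b))"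

text \<open>A train that has not yet reached a node visits it with a positive index.\<close>

definition initial_conditions ::
  "('n, 'e, 'l, 'i::linorder) railway \<Rightarrow> ('n, 'l, 'i) state \<Rightarrow> 'i horizon
    \<Rightarrow> ('n, 'e, 'l, 'i) variables \<Rightarrow> bool" where
  "initial_conditions R x f v \<longleftrightarrow>
     (\<forall>i \<in> edge_trains R x. 0 < f i \<longrightarrow>
        dep v i 0 = 0 \<and>
        (\<forall>j \<in> trains R. \<forall>b < f j. j \<noteq> i \<and> same_track R x i 0 j b \<longrightarrow>
           precedes (z_edge v) i j (path_edge R x i 0))) \<and>
     (\<forall>i \<in> node_trains R x.
        z_slot v i (path_node R x i 0) (the (slot x i)) \<and>
        (\<forall>j \<in> trains R. \<forall>b. j \<noteq> i \<and> 0 < b \<and> b \<le> f j \<and> path_node R x j b = path_node R x i 0 \<longrightarrow>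
           precedes (z_node v) i j (path_node R x i 0)))"

definition feasible_solution ::
  "('n, 'e, 'l, 'i::linorder) railway \<Rightarrow> ('n, 'l, 'i) state \<Rightarrow> 'i horizon
    \<Rightarrow> ('n, 'e, 'l, 'i) variables \<Rightarrow> bool" where
  "feasible_solution R x f v \<longleftrightarrow>
     (\<forall>i \<in> trains R. \<forall>k < f i. 0 \<le> dep v i k) \<and>
     sequentiality R x f v \<and> edge_conflicts R x f v \<and> node_conflicts R x f v \<and>
     initial_conditions R x f v"

definition feasible ::
  "('n, 'e, 'l, 'i::linorder) railway \<Rightarrow> ('n, 'l, 'i) state \<Rightarrow> 'i horizon \<Rightarrow> bool" where
  "feasible R x f \<longleftrightarrow> (\<exists>v. feasible_solution R x f v)"

definition deadlocked ::
  "('n, 'e, 'l, 'i::linorder) railway \<Rightarrow> ('n, 'l, 'i) state \<Rightarrow> bool" where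
  "deadlocked R x \<longleftrightarrow> \<not> feasible R x (full_horizon R x)"

definition safe_state :: "('n, 'e, 'l, 'i) railway \<Rightarrow> ('n, 'l, 'i) state \<Rightarrow> bool" where
  "safe_state R x \<longleftrightarrow>
     (\<forall>i \<in> trains R. i \<in> node_trains R x) \<and>
     (\<forall>n \<in> nodes R. \<exists>l \<in> slots R n. \<not> (\<exists>i \<in> trains R. last_node x i = n \<and> slot x i = Some l))"

text \<open>A horizon determines the nodes but not the slots of its terminal state. Since distinct trains
  at a node occupy distinct slots, the choice of the slots does not matter for safety.\<close>

definition safe_terminal_state ::
  "('n, 'e, 'l, 'i) railway \<Rightarrow> ('n, 'l, 'i) state \<Rightarrow> 'i horizon \<Rightarrow> bool" where
  "safe_terminal_state R x f \<longleftrightarrow>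
     (\<exists>x'. admissible R x' \<and> (\<forall>i \<in> trains R. last_node x' i = path_node R x i (f i)) \<and>
           safe_state R x')"

definition non_regressive ::
  "('n, 'e, 'l, 'i) railway \<Rightarrow> ('n, 'l, 'i) state \<times> 'i horizon
    \<Rightarrow> ('n, 'l, 'i) state \<times> 'i horizon \<Rightarrow> bool" where
  "non_regressive R = (\<lambda>(x, f) (x', f').
     \<forall>i \<in> trains R. position R x i + f i \<le> position R x' i + f' i)"

definition num_slots :: "('n, 'e, 'l, 'i) railway \<Rightarrow> 'n \<Rightarrow> enat" where
  "num_slots R n = (if finite (slots R n) then enat (card (slots R n)) else \<infinity>)"

text \<open>Step (3) of the procedure: \<open>settle R x is \<eta> f g\<close> processes the trains in the list \<open>is\<close> from the
  values \<open>\<eta>\<close> and \<open>f\<close>, and ends with the horizon \<open>g\<close>. Terminal nodes have \<open>\<eta> = \<infinity>\<close>.\<close>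

inductive settle ::
  "('n, 'e, 'l, 'i) railway \<Rightarrow> ('n, 'l, 'i) state \<Rightarrow> 'i list \<Rightarrow> ('n \<Rightarrow> enat)
    \<Rightarrow> 'i horizon \<Rightarrow> 'i horizon \<Rightarrow> bool"
  for R x where
  finished: "settle R x [] \<eta> f f"
| advance: "\<eta> (path_node R x i (f i)) \<le> 1 \<Longrightarrow> settle R x (i # is) \<eta> (f(i := f i + 1)) g
    \<Longrightarrow> settle R x (i # is) \<eta> f g"
| stop: "\<not> \<eta> (path_node R x i (f i)) \<le> 1 \<Longrightarrow> n = path_node R x i (f i)
    \<Longrightarrow> settle R x is (\<eta>(n := \<eta> n - 1)) f g \<Longrightarrow> settle R x (i # is) \<eta> f g"

definition settled ::
  "('n, 'e, 'l, 'i) railway \<Rightarrow> ('n, 'l, 'i) state \<Rightarrow> 'i horizon \<Rightarrow> 'i horizon \<Rightarrow> bool" where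
  "settled R x f g \<longleftrightarrow>
     (\<exists>is. distinct is \<and> set is = trains R \<and> settle R x is (num_slots R) f g)"

text \<open>\<open>returns R x f h\<close>: the procedure, entered at step (2) with \<open>f\<close>, can end with \<open>h\<close>.\<close>

inductive returns ::
  "('n, 'e, 'l, 'i::linorder) railway \<Rightarrow> ('n, 'l, 'i) state \<Rightarrow> 'i horizon \<Rightarrow> 'i horizon \<Rightarrow> bool"
  for R x where
  success: "settled R x f g \<Longrightarrow> feasible R x g \<Longrightarrow> returns R x f g"
| extend: "settled R x f g \<Longrightarrow> \<not> feasible R x g \<Longrightarrow> i \<in> trains R \<Longrightarrow> g i < full_horizon R x i
    \<Longrightarrow> returns R x (g(i := g i + 1)) h \<Longrightarrow> returns R x f h"
| exhausted: "settled R x f g \<Longrightarrow> \<not> feasible R x g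
    \<Longrightarrow> \<not> (\<exists>i \<in> trains R. g i < full_horizon R x i) \<Longrightarrow> returns R x f g"

definition initial_horizon ::
  "('n, 'e, 'l, 'i) railway \<Rightarrow> ('n, 'l, 'i) state \<Rightarrow> 'i horizon \<Rightarrow> bool" where
  "initial_horizon R x f \<longleftrightarrow>
     is_horizon R x f \<and> (\<forall>i \<in> trains R. 0 < full_horizon R x i \<longrightarrow> 1 \<le> f i)"

definition safe_optimization_horizon ::
  "('n, 'e, 'l, 'i::linorder) railway \<Rightarrow> ('n, 'l, 'i) state \<Rightarrow> 'i horizon \<Rightarrow> bool" where
  "safe_optimization_horizon R x f \<longleftrightarrow> (\<exists>f\<^sub>0. initial_horizon R x f\<^sub>0 \<and> returns R x f\<^sub>0 f)"

text \<open>At the very instant of a departure a train still counts as being at the node, and at the very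
  instant of an arrival it already does.\<close>

definition operates_to ::
  "('n, 'e, 'l, 'i) railway \<Rightarrow> ('n, 'l, 'i) state \<Rightarrow> 'i horizon
    \<Rightarrow> ('n, 'e, 'l, 'i) variables \<Rightarrow> real \<Rightarrow> ('n, 'l, 'i) state \<Rightarrow> bool" where
  "operates_to R x f v \<Delta> x' \<longleftrightarrow> (\<forall>i \<in> trains R.
     ((f i = 0 \<or> \<Delta> \<le> dep v i 0) \<and>
      last_node x' i = last_node x i \<and> fraction x' i = fraction x i \<and> slot x' i = slot x i) \<or>
     (\<exists>k < f i. dep v i k < \<Delta> \<and> \<Delta> < dep v i k + remaining_time R x i k \<and>
        last_node x' i = path_node R x i k \<and>
        fraction x' i = (if k = 0 then fraction x i else 0)
          + (\<Delta> - dep v i k) / travel_time R i (path_edge R x i k) \<and>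
        slot x' i = None) \<or>
     (\<exists>k < f i. dep v i k + remaining_time R x i k \<le> \<Delta> \<and> (k + 1 < f i \<longrightarrow> \<Delta> \<le> dep v i (k + 1)) \<and>
        last_node x' i = path_node R x i (k + 1) \<and>
        fraction x' i = 0 \<and>
        (\<exists>l \<in> slots R (path_node R x i (k + 1)).
           z_slot v i (path_node R x i (k + 1)) l \<and> slot x' i = Some l)))"

definition recomputation ::
  "('n, 'e, 'l, 'i::linorder) railway \<Rightarrow> real \<Rightarrow> ('n, 'l, 'i) state \<times> 'i horizon
    \<Rightarrow> ('n, 'l, 'i) state \<times> 'i horizon \<Rightarrow> bool" where
  "recomputation R \<Delta> = (\<lambda>(x, f) (x', f').
     (\<exists>v. feasible_solution R x f v \<and> operates_to R x f v \<Delta> x') \<and>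
     is_horizon R x' f' \<and> safe_terminal_state R x' f' \<and> non_regressive R (x, f) (x', f'))"

text \<open>The transitive closure covers the next and all subsequent recomputation times.\<close>

definition recursively_feasible ::
  "('n, 'e, 'l, 'i::linorder) railway \<Rightarrow> real \<Rightarrow> ('n, 'l, 'i) state \<Rightarrow> 'i horizon \<Rightarrow> bool" where
  "recursively_feasible R \<Delta> x f \<longleftrightarrow>
     (\<forall>x' f'. (recomputation R \<Delta>)\<^sup>+\<^sup>+ (x, f) (x', f') \<longrightarrow> feasible R x' f')"

end

theory Submission
  imports Defs
begin

text \<open>Feasibility is a matter of order, not of timing: as long as the order in which the trains use
  tracks and slots is kept, departures that lie ahead can be delayed. Two facts carry the proof.

  \<^item> Extension (\<open>feasible_extend\<close>). If \<open>f\<close> is feasible, \<open>g\<close> is no shorter for any train, and the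
    trains leave a free slot in every node both when they stand at the ends of \<open>f\<close> and when they
    stand at the ends of \<open>g\<close>, then \<open>g\<close> is feasible. After a solution for \<open>f\<close> has been carried out,
    the trains are moved one at a time, each directly to its end in \<open>g\<close>, while all others stand
    still; the moving train only has to find a free slot in each node that it passes. This can fill
    up at most the node at which it stops. A node that is full although it has room in \<open>g\<close> hosts a
    train that has not yet been moved, and that train is moved next. Hence at any time all nodes have
    a free slot, except possibly the one that the next train leaves. One step of one train is
    \<open>feasible_advance\<close>: the new departure takes place after everything else.

  \<^item> Continuation (\<open>feasible_after_operation\<close>). After an operation the unfinished rest of the
    solution, with shifted departure times, solves the program of the new state with the
    correspondingly shortened horizon. One adjustment is needed: a train that is transiting an edge
    restarts with departure time 0 although part of the edge is already behind it, and the other trains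
    still have to wait for its full travel time. Therefore all remaining departures are delayed by a
    common constant that is at least all these travel times.

  The procedure keeps enough slots free at the ends of its horizons and stops with an infeasible
  horizon only if that is the full one. Since terminal nodes have infinitely many slots, the full
  horizon leaves room everywhere, so a feasible result of the procedure extends to the full horizon;
  this yields (a). For (b), a recomputation continues the operation with the shortened horizon, whose
  end nodes are the old ones, and a safe non-regressive horizon extends it; the properties used
  (\<open>operable\<close>) are preserved, so the argument can be iterated.\<close>

section \<open>Remaining paths\<close>

text \<open>Conditions on each train separately that admissible states satisfy. Nothing is required of the slots
  and tracks held by different trains: the constraints of a feasible program keep them apart.\<close>

definition regular_state :: "('n, 'e, 'l, 'i) railway \<Rightarrow> ('n, 'l, 'i) state \<Rightarrow> bool" where
  "regular_state R x \<longleftrightarrow>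
     (\<forall>i \<in> trains R. last_node x i \<in> set (route R i) \<and> 0 \<le> fraction x i \<and> fraction x i \<le> 1 \<and>
        (slot x i \<noteq> None \<longrightarrow> fraction x i = 0))"

lemma admissible_imp_regular_state: "admissible R x \<Longrightarrow> regular_state R x"
  by (auto simp: admissible_def regular_state_def node_trains_def Let_def)

lemma position_eqI:
  assumes "distinct (route R i)" "k < length (route R i)" "route R i ! k = last_node x i"
  shows "position R x i = k"
  unfolding position_def
proof (rule the_equality)
  fix k' assume "k' < length (route R i) \<and> route R i ! k' = last_node x i"
  with assms show "k' = k" by (metis nth_eq_iff_index_eq)
qed (use assms in simp)

context
  fixes R :: "('n, 'e, 'l, 'i) railway" and x :: "('n, 'l, 'i) state" and i :: 'i
  assumes wf: "wf_railway R" and i: "i \<in> trains R"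
begin

lemma route_facts:
  shows "distinct (route R i)" "set (route R i) \<subseteq> nodes R"
    "length (route R i) = Suc (length (tracks R i))"
    "set (tracks R i) \<subseteq> single_tracks R \<union> double_tracks R"
    "k < length (tracks R i) \<Longrightarrow> ends R (tracks R i ! k) = {route R i ! k, route R i ! Suc k}"
    "infinite (slots R (last (route R i)))"
    "e \<in> single_tracks R \<union> double_tracks R \<Longrightarrow> 0 < travel_time R i e"
  using wf i by (auto simp: wf_railway_def)

lemma position_facts:
  assumes "regular_state R x"
  shows "position R x i \<le> length (tracks R i)" "route R i ! position R x i = last_node x i"
proof -
  have "last_node x i \<in> set (route R i)"
    using assms i by (auto simp: regular_state_def)
  then obtain k where k: "k < length (route R i)" "route R i ! k = last_node x i"
    by (auto simp: in_set_conv_nth)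
  then have "position R x i = k"
    by (intro position_eqI route_facts)
  with k show "position R x i \<le> length (tracks R i)" "route R i ! position R x i = last_node x i"
    using route_facts(3) by auto
qed

lemma position_add_full_horizon:
  assumes "regular_state R x"
  shows "position R x i + full_horizon R x i = length (tracks R i)"
  using position_facts(1)[OF assms] by (simp add: full_horizon_def)

lemma path_node_in_nodes:
  assumes "regular_state R x" "k \<le> full_horizon R x i"
  shows "path_node R x i k \<in> nodes R"
  using position_add_full_horizon[OF assms(1)] assms(2) route_facts(2,3)
    nth_mem[of "position R x i + k" "route R i"]
  by (auto simp: path_node_def)

lemma path_node_inject:
  assumes "regular_state R x" "a \<le> full_horizon R x i" "b \<le> full_horizon R x i"
  shows "path_node R x i a = path_node R x i b \<longleftrightarrow> a = b"
  using position_add_full_horizon[OF assms(1)] assms(2,3) route_facts(1,3)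
  by (auto simp: path_node_def nth_eq_iff_index_eq)

lemma path_node_full_horizon:
  assumes "regular_state R x"
  shows "path_node R x i (full_horizon R x i) = last (route R i)"
  using position_add_full_horizon[OF assms] route_facts(3)
  by (simp add: path_node_def last_conv_nth flip: length_greater_0_conv)

lemma path_edge_ends:
  assumes "regular_state R x" "k < full_horizon R x i"
  shows "ends R (path_edge R x i k) = {path_node R x i k, path_node R x i (Suc k)}"
  using position_add_full_horizon[OF assms(1)] assms(2) route_facts(5)[of "position R x i + k"]
  by (simp add: path_edge_def path_node_def)

lemma path_edge_inject:
  assumes "regular_state R x" "a < full_horizon R x i" "b < full_horizon R x i"
  shows "path_edge R x i a = path_edge R x i b \<longleftrightarrow> a = b"
proof
  assume "path_edge R x i a = path_edge R x i b"
  then have "{path_node R x i a, path_node R x i (Suc a)} = {path_node R x i b, path_node R x i (Suc b)}"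
    using path_edge_ends assms by metis
  then show "a = b"
    using assms path_node_inject[OF assms(1)] by (auto simp: doubleton_eq_iff)
qed simp

lemma travel_time_pos:
  assumes "regular_state R x" "k < full_horizon R x i"
  shows "0 < travel_time R i (path_edge R x i k)"
proof -
  have "path_edge R x i k \<in> set (tracks R i)"
    using position_add_full_horizon[OF assms(1)] assms(2) by (simp add: path_edge_def)
  then show ?thesis
    using route_facts(4) by (intro route_facts(7)) auto
qed

lemma remaining_time_bounds:
  assumes "regular_state R x" "k < full_horizon R x i"
  shows "0 \<le> remaining_time R x i k" "remaining_time R x i k \<le> travel_time R i (path_edge R x i k)"
    "k \<noteq> 0 \<or> i \<in> node_trains R x \<Longrightarrow> remaining_time R x i k = travel_time R i (path_edge R x i k)"
proof -
  have fr: "0 \<le> fraction x i" "fraction x i \<le> 1" "i \<in> node_trains R x \<Longrightarrow> fraction x i = 0"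
    using assms(1) i by (auto simp: regular_state_def node_trains_def)
  note pos = travel_time_pos[OF assms]
  show "0 \<le> remaining_time R x i k"
    using fr pos by (simp add: remaining_time_def)
  show "remaining_time R x i k \<le> travel_time R i (path_edge R x i k)"
    using fr pos mult_left_mono[of "1 - fraction x i" 1 "travel_time R i (path_edge R x i k)"]
    by (auto simp: remaining_time_def)
  show "remaining_time R x i k = travel_time R i (path_edge R x i k)"
    if "k \<noteq> 0 \<or> i \<in> node_trains R x"
    using fr that by (auto simp: remaining_time_def)
qed

end

section \<open>The constraints in terms of ordered pairs of trains\<close>

lemma precedes_flip: "i \<noteq> j \<Longrightarrow> precedes z j i a \<longleftrightarrow> \<not> precedes z i j a"
  by (auto simp: precedes_def)

lemma same_track_sym: "same_track R x i a j b \<longleftrightarrow> same_track R x j b i a"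
  by (auto simp: same_track_def)

lemma same_track_imp_eq: "same_track R x i a j b \<Longrightarrow> path_edge R x j b = path_edge R x i a"
  by (simp add: same_track_def)

lemma edge_conflicts_iff:
  "edge_conflicts R x f v \<longleftrightarrow>
     (\<forall>i \<in> trains R. \<forall>j \<in> trains R. \<forall>a < f i. \<forall>b < f j.
        i \<noteq> j \<and> same_track R x i a j b \<and> precedes (z_edge v) i j (path_edge R x i a) \<longrightarrow>
        dep v i a + travel_time R i (path_edge R x i a) \<le> dep v j b)"
  (is "?L \<longleftrightarrow> ?R")
proof
  assume L: ?L
  show ?R
  proof (intro ballI allI impI)
    fix i j a b
    let ?e = "path_edge R x i a"
    assume *: "i \<in> trains R" "j \<in> trains R" "a < f i" "b < f j"
      "i \<noteq> j \<and> same_track R x i a j b \<and> precedes (z_edge v) i j ?e"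
    then have **: "same_track R x j b i a" "path_edge R x j b = ?e"
      by (auto simp: same_track_def)
    consider "i < j" | "j < i" using * by fastforce
    then show "dep v i a + travel_time R i ?e \<le> dep v j b"
    proof cases
      case 1
      with L[unfolded edge_conflicts_def, rule_format, of i j a b ?e] * show ?thesis
        by (simp add: precedes_def)
    next
      case 2
      with L[unfolded edge_conflicts_def, rule_format, of j i b a ?e] * ** show ?thesis
        by (simp add: precedes_def)
    qed
  qed
next
  assume R: ?R
  show ?L
    unfolding edge_conflicts_def
  proof (intro ballI allI impI)
    fix i j a b e
    assume *: "i \<in> trains R" "j \<in> trains R" "a < f i" "b < f j"
      "i < j \<and> same_track R x i a j b \<and> e = path_edge R x i a"
    then have **: "i \<noteq> j" "\<not> j < i" "same_track R x j b i a" "path_edge R x j b = e"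
      by (auto simp: same_track_def)
    with R[rule_format, of i j a b] R[rule_format, of j i b a] *
    show "(z_edge v i j e \<longrightarrow> dep v i a + travel_time R i e \<le> dep v j b) \<and>
        (\<not> z_edge v i j e \<longrightarrow> dep v j b + travel_time R j e \<le> dep v i a)"
      by (auto simp: precedes_def)
  qed
qed

text \<open>The first half of the node constraints: at each node of its path a train uses exactly one slot.\<close>

definition slot_assignment ::
  "('n, 'e, 'l, 'i) railway \<Rightarrow> ('n, 'l, 'i) state \<Rightarrow> 'i horizon
    \<Rightarrow> ('n, 'e, 'l, 'i) variables \<Rightarrow> bool" where
  "slot_assignment R x f v \<longleftrightarrow>
     (\<forall>i \<in> trains R. \<forall>k. visits R x f i k \<longrightarrow>
        (\<exists>!l. l \<in> slots R (path_node R x i k) \<and> z_slot v i (path_node R x i k) l))"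

lemma node_conflicts_iff:
  "node_conflicts R x f v \<longleftrightarrow> slot_assignment R x f v \<and>
     (\<forall>i \<in> trains R. \<forall>j \<in> trains R. \<forall>a b. \<forall>l \<in> slots R (path_node R x i a).
        i \<noteq> j \<and> visits R x f i a \<and> visits R x f j b \<and> path_node R x j b = path_node R x i a \<and>
        z_slot v i (path_node R x i a) l \<and> z_slot v j (path_node R x i a) l \<and>
        precedes (z_node v) i j (path_node R x i a) \<longrightarrow>
        dep_from f v i a \<le> dep_towards v j b)"
  (is "?L \<longleftrightarrow> _ \<and> ?R")
proof (intro iffI conjI)
  assume L: ?L
  then show "slot_assignment R x f v"
    by (simp add: node_conflicts_def slot_assignment_def)
  show ?R
  proof (intro ballI allI impI)
    fix i j a b l
    let ?n = "path_node R x i a"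
    assume *: "i \<in> trains R" "j \<in> trains R" "l \<in> slots R ?n"
      "i \<noteq> j \<and> visits R x f i a \<and> visits R x f j b \<and> path_node R x j b = ?n \<and>
        z_slot v i ?n l \<and> z_slot v j ?n l \<and> precedes (z_node v) i j ?n"
    consider "i < j" | "j < i" using * by fastforce
    then show "dep_from f v i a \<le> dep_towards v j b"
    proof cases
      case 1
      with L[unfolded node_conflicts_def, THEN conjunct2, rule_format, of i j l ?n a b] *
      show ?thesis by (simp add: precedes_def)
    next
      case 2
      with L[unfolded node_conflicts_def, THEN conjunct2, rule_format, of j i l ?n b a] *
      show ?thesis by (simp add: precedes_def)
    qed
  qed
next
  assume R: "slot_assignment R x f v \<and> ?R"
  have "\<forall>i \<in> trains R. \<forall>j \<in> trains R. \<forall>a b. \<forall>n. \<forall>l \<in> slots R n.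
        i < j \<and> visits R x f i a \<and> visits R x f j b \<and>
        path_node R x i a = n \<and> path_node R x j b = n \<and>
        z_slot v i n l \<and> z_slot v j n l \<longrightarrow>
        (z_node v i j n \<longrightarrow> dep_from f v i a \<le> dep_towards v j b) \<and>
        (\<not> z_node v i j n \<longrightarrow> dep_from f v j b \<le> dep_towards v i a)"
    (is "?C")
  proof (intro ballI allI, rule impI)
    fix i j a b n l
    assume *: "i \<in> trains R" "j \<in> trains R" "l \<in> slots R n"
      "i < j \<and> visits R x f i a \<and> visits R x f j b \<and>
        path_node R x i a = n \<and> path_node R x j b = n \<and> z_slot v i n l \<and> z_slot v j n l"
    then have "i \<noteq> j" "\<not> j < i" by auto
    with R[THEN conjunct2, rule_format, of i j l a b] R[THEN conjunct2, rule_format, of j i l b a] *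
    show "(z_node v i j n \<longrightarrow> dep_from f v i a \<le> dep_towards v j b) \<and>
        (\<not> z_node v i j n \<longrightarrow> dep_from f v j b \<le> dep_towards v i a)"
      by (simp add: precedes_def)
  qed
  moreover have "slot_assignment R x f v" using R ..
  ultimately show ?L
    unfolding node_conflicts_def slot_assignment_def by (intro conjI)
qed

lemma feasible_cong:
  assumes "\<And>i. i \<in> trains R \<Longrightarrow> f i = g i" "feasible R x f"
  shows "feasible R x g"
proof -
  from assms(2) obtain v where v: "feasible_solution R x f v" by (auto simp: feasible_def)
  have vis: "visits R x g i k \<longleftrightarrow> visits R x f i k" "dep_from g v i k = dep_from f v i k"
    if "i \<in> trains R" for i k
    using assms(1)[OF that] by (simp_all add: visits_def dep_from_def)
  have "sequentiality R x g v"
    using v assms(1) by (simp add: feasible_solution_def sequentiality_def)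
  moreover have "edge_conflicts R x g v"
    using v assms(1) by (simp add: feasible_solution_def edge_conflicts_def)
  moreover have "node_conflicts R x g v"
    using v vis by (simp add: feasible_solution_def node_conflicts_def)
  moreover have "initial_conditions R x g v"
    using v assms(1)
    by (simp add: feasible_solution_def initial_conditions_def node_trains_def edge_trains_def)
  moreover have "\<forall>i \<in> trains R. \<forall>k < g i. 0 \<le> dep v i k"
    using v assms(1) by (simp add: feasible_solution_def)
  ultimately have "feasible_solution R x g v"
    by (simp add: feasible_solution_def)
  then show ?thesis by (auto simp: feasible_def)
qed

section \<open>Moving a single train\<close>

text \<open>The precedence variables \<open>z\<close>, changed so that train \<open>i\<close> comes after all other trains at the node
  or edge \<open>a\<close>.\<close>

definition put_last :: "'i \<Rightarrow> 'a \<Rightarrow> ('i \<Rightarrow> 'i \<Rightarrow> 'a \<Rightarrow> bool) \<Rightarrow> 'i \<Rightarrow> 'i \<Rightarrow> 'a \<Rightarrow> bool" where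
  "put_last i a z j k b \<longleftrightarrow> (if b = a \<and> k = i then True else if b = a \<and> j = i then False else z j k b)"

lemma precedes_put_last:
  "j \<noteq> k \<Longrightarrow> precedes (put_last i a z) j k b \<longleftrightarrow>
     (if b = a \<and> k = i then True else if b = a \<and> j = i then False else precedes z j k b)"
  by (auto simp: precedes_def put_last_def)

text \<open>Lengthening the path of one train by one edge. Only the trains that end at the new node block its
  slots for good. The hypothesis on trains in transit excludes a horizon that cuts such a train off
  before its next node, whose slot it holds already.\<close>

lemma feasible_advance:
  fixes R :: "('n, 'e, 'l, 'i::linorder) railway"
  assumes wf: "wf_railway R" and reg: "regular_state R x" and hor: "is_horizon R x f"
    and pos: "\<And>j. j \<in> edge_trains R x \<Longrightarrow> 0 < f j"
    and feas: "feasible R x f"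
    and i: "i \<in> trains R" and less: "f i < full_horizon R x i"
    and n: "n = path_node R x i (Suc (f i))"
    and room: "infinite (slots R n) \<or>
      card {j \<in> trains R - {i}. path_node R x j (f j) = n} < card (slots R n)"
  shows "feasible R x (f(i := Suc (f i)))"
proof -
  from feas obtain v where v: "feasible_solution R x f v" by (auto simp: feasible_def)
  then have nonneg: "\<And>j k. j \<in> trains R \<Longrightarrow> k < f j \<Longrightarrow> 0 \<le> dep v j k"
    and seq: "sequentiality R x f v" and edge: "edge_conflicts R x f v"
    and node: "node_conflicts R x f v" and init: "initial_conditions R x f v"
    by (auto simp: feasible_solution_def)
  have fin: "finite (trains R)" using wf by (simp add: wf_railway_def)
  have f_le: "f j \<le> full_horizon R x j" if "j \<in> trains R" for j
    using hor that by (simp add: is_horizon_def)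
  have node_sub: "j \<in> trains R" if "j \<in> node_trains R x" for j
    using that by (simp add: node_trains_def)
  have edge_sub: "j \<in> trains R" if "j \<in> edge_trains R x" for j
    using that by (simp add: edge_trains_def)

  define e where "e = path_edge R x i (f i)"
  \<comment> \<open>As no node is repeated, the train meets \<open>n\<close> and \<open>e\<close> nowhere else, so the variables of the train
    there are still free to choose.\<close>
  have new_node: "path_node R x i k \<noteq> n" if "k \<le> f i" for k
    using that less path_node_inject[OF wf i reg, of k "Suc (f i)"] by (simp add: n)
  have new_edge: "path_edge R x i a \<noteq> e" if "a < f i" for a
    using that less path_edge_inject[OF wf i reg, of a "f i"] by (simp add: e_def)

  \<comment> \<open>The new departure time: all other trains have departed and left their edges by then.\<close>
  obtain T where T0: "0 \<le> T" and
    T: "\<And>j b. j \<in> trains R \<Longrightarrow> b < f j \<Longrightarrow> dep v j b + travel_time R j (path_edge R x j b) \<le> T"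
  proof -
    let ?S = "insert 0 (\<Union>j \<in> trains R.
      (\<lambda>b. dep v j b + travel_time R j (path_edge R x j b)) ` {..<f j})"
    have "bdd_above ?S" using fin by (intro bdd_above_finite) auto
    then obtain T where "\<And>q. q \<in> ?S \<Longrightarrow> q \<le> T" unfolding bdd_above_def by blast
    then show ?thesis by (intro that[of T]) auto
  qed
  have T_dep: "dep v j b \<le> T" "dep v j b + remaining_time R x j b \<le> T"
    if "j \<in> trains R" "b < f j" for j b
  proof -
    have "b < full_horizon R x j" using that f_le[of j] by simp
    with T[OF that] travel_time_pos[OF wf that(1) reg] remaining_time_bounds[OF wf that(1) reg]
    show "dep v j b \<le> T" "dep v j b + remaining_time R x j b \<le> T" by (smt (verit))+
  qed

  \<comment> \<open>A slot of the new node that no train keeps until the end.\<close>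
  obtain l where l: "l \<in> slots R n" and l_free:
    "\<And>j. j \<in> trains R \<Longrightarrow> j \<noteq> i \<Longrightarrow> path_node R x j (f j) = n \<Longrightarrow> \<not> z_slot v j n l"
  proof -
    let ?S = "{j \<in> trains R - {i}. path_node R x j (f j) = n}"
    let ?s = "\<lambda>j. THE l. l \<in> slots R n \<and> z_slot v j n l"
    have s: "l = ?s j" if "j \<in> ?S" "l \<in> slots R n" "z_slot v j n l" for j l
    proof -
      have "visits R x f j (f j)"
        using that(1) pos[of j] by (cases "slot x j") (auto simp: visits_def node_trains_def edge_trains_def)
      then have "\<exists>!l. l \<in> slots R n \<and> z_slot v j n l"
        using node[unfolded node_conflicts_def, THEN conjunct1, rule_format, of j "f j"] that(1)
        by auto
      then show ?thesis using that(2,3) by (metis (no_types, lifting) the_equality)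
    qed
    have finS: "finite ?S" using fin by simp
    have "\<not> slots R n \<subseteq> ?s ` ?S"
    proof
      assume sub: "slots R n \<subseteq> ?s ` ?S"
      then have "finite (slots R n)" using finS by (rule finite_surj[rotated])
      with room have "card ?S < card (slots R n)" by simp
      also have "\<dots> \<le> card (?s ` ?S)" using sub finS by (intro card_mono) auto
      also have "\<dots> \<le> card ?S" using finS by (rule card_image_le)
      finally show False by simp
    qed
    then obtain l where "l \<in> slots R n" "l \<notin> ?s ` ?S" by blast
    then show ?thesis using s by (intro that[of l]) auto
  qed

  define f' where "f' = f(i := Suc (f i))"
  define v' where "v' = v\<lparr>dep := (\<lambda>j k. if j = i \<and> k = f i then T else dep v j k),
      z_edge := put_last i e (z_edge v), z_node := put_last i n (z_node v),
      z_slot := (\<lambda>j m l'. if j = i \<and> m = n then l' = l else z_slot v j m l')\<rparr>"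
  have dep': "dep v' j k = (if j = i \<and> k = f i then T else dep v j k)" for j k
    by (simp add: v'_def)
  have slot': "z_slot v' j m l' \<longleftrightarrow> (if j = i \<and> m = n then l' = l else z_slot v j m l')" for j m l'
    by (simp add: v'_def)
  have edge': "precedes (z_edge v') j k e' \<longleftrightarrow> (if e' = e \<and> k = i then True
      else if e' = e \<and> j = i then False else precedes (z_edge v) j k e')" if "j \<noteq> k" for j k e'
    using that by (simp add: v'_def precedes_put_last)
  have node': "precedes (z_node v') j k m \<longleftrightarrow> (if m = n \<and> k = i then True
      else if m = n \<and> j = i then False else precedes (z_node v) j k m)" if "j \<noteq> k" for j k m
    using that by (simp add: v'_def precedes_put_last)
  have less': "k < f' j \<longleftrightarrow> k < f j \<or> (j = i \<and> k = f i)" for j k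
    by (auto simp: f'_def)
  have le': "k \<le> f' j \<longleftrightarrow> k \<le> f j \<or> (j = i \<and> k = Suc (f i))" for j k
    by (auto simp: f'_def)
  have visits': "visits R x f' j k \<longleftrightarrow> visits R x f j k \<or> (j = i \<and> k = Suc (f i))" for j k
    by (auto simp: visits_def le')
  have slot_old: "z_slot v' j (path_node R x j k) l' \<longleftrightarrow> z_slot v j (path_node R x j k) l'"
    if "k \<le> f j" for j k l'
    using that new_node[of k] by (auto simp: slot')
  have path_n: "path_node R x i (Suc (f i)) = n" and path_e: "path_edge R x i (f i) = e"
    by (simp_all add: n e_def)

  have "sequentiality R x f' v'"
    unfolding sequentiality_def
  proof (intro ballI allI impI)
    fix j k assume j: "j \<in> trains R" and k: "1 \<le> k \<and> k < f' j"
    show "dep v' j (k - 1) + remaining_time R x j (k - 1) \<le> dep v' j k"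
    proof (cases "j = i \<and> k = f i")
      case True
      then have "dep v j (k - 1) + remaining_time R x j (k - 1) \<le> T"
        using k by (intro T_dep j) auto
      with True k show ?thesis by (auto simp: dep')
    next
      case False
      with seq j k show ?thesis by (auto simp: dep' less' sequentiality_def)
    qed
  qed
  moreover have "edge_conflicts R x f' v'"
    unfolding edge_conflicts_iff
  proof (intro ballI allI impI, elim conjE)
    fix j k a b
    assume *: "j \<in> trains R" "k \<in> trains R" "a < f' j" "b < f' k" "j \<noteq> k"
      and same: "same_track R x j a k b"
      and prec: "precedes (z_edge v') j k (path_edge R x j a)"
    have eq: "path_edge R x k b = path_edge R x j a" using same by (rule same_track_imp_eq)
    consider "j = i" "a = f i" | "k = i" "b = f i" | "a < f j" "b < f k"
      using * by (auto simp: less')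
    then show "dep v' j a + travel_time R j (path_edge R x j a) \<le> dep v' k b"
    proof cases
      case 1
      then show ?thesis using prec * by (simp add: edge' path_e)
    next
      case 2
      then show ?thesis using T[of j a] * by (simp add: dep' less')
    next
      case 3
      have "precedes (z_edge v) j k (path_edge R x j a)"
        using prec * 3 new_edge[of a] new_edge[of b] eq by (auto simp: edge' split: if_splits)
      then have "dep v j a + travel_time R j (path_edge R x j a) \<le> dep v k b"
        using edge[unfolded edge_conflicts_iff] * same 3 by simp
      with 3 show ?thesis by (auto simp: dep')
    qed
  qed
  moreover have "node_conflicts R x f' v'"
    unfolding node_conflicts_iff slot_assignment_def
  proof (intro conjI ballI allI impI; (elim conjE)?)
    fix j k assume j: "j \<in> trains R" and k: "visits R x f' j k"
    show "\<exists>!l. l \<in> slots R (path_node R x j k) \<and> z_slot v' j (path_node R x j k) l"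
    proof (cases "j = i \<and> k = Suc (f i)")
      case True
      then show ?thesis using l by (auto simp: slot' path_n)
    next
      case False
      with k have "visits R x f j k" by (simp add: visits')
      moreover from this have "k \<le> f j" by (simp add: visits_def)
      ultimately show ?thesis using node j by (simp add: slot_old node_conflicts_def)
    qed
  next
    fix j k a b l'
    let ?m = "path_node R x j a"
    assume *: "j \<in> trains R" "k \<in> trains R" "l' \<in> slots R ?m" "j \<noteq> k" "visits R x f' j a"
      "visits R x f' k b" "path_node R x k b = ?m" "z_slot v' j ?m l'" "z_slot v' k ?m l'"
      "precedes (z_node v') j k ?m"
    consider "j = i" "a = Suc (f i)" | "j \<noteq> i" "k = i" "b = Suc (f i)" "visits R x f j a"
      | "visits R x f j a" "visits R x f k b"
      using * by (auto simp: visits')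
    then show "dep_from f' v' j a \<le> dep_towards v' k b"
    proof cases
      case 1
      then show ?thesis using * by (simp add: node' path_n)
    next
      case 2
      then have "z_slot v j n l" "?m = n" using * by (auto simp: slot' path_n)
      then have "a < f j" using 2 * l_free[of j] by (cases "a = f j") (auto simp: visits_def)
      then show ?thesis using T_dep[of j a] 2 *
        by (auto simp: dep_from_def dep_towards_def dep' less')
    next
      case 3
      then have ab: "a \<le> f j" "b \<le> f k" by (simp_all add: visits_def)
      then have "z_slot v j ?m l'" "z_slot v k ?m l'"
        using * slot_old[of a j] slot_old[of b k] by auto
      moreover have "precedes (z_node v) j k ?m"
        using * ab new_node[of a] new_node[of b] by (auto simp: node' split: if_splits)
      ultimately have old: "dep_from f v j a \<le> dep_towards v k b"
        using node[unfolded node_conflicts_iff, THEN conjunct2] * 3 by metis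
      \<comment> \<open>In the old solution the train that goes first cannot stay for ever; in particular, a train
        with which \<open>i\<close> shares its old end slot precedes \<open>i\<close>, so that the departure of \<open>i\<close> is not
        constrained.\<close>
      then have "a < f j"
        by (auto simp: dep_from_def dep_towards_def split: if_splits)
      then have "dep_from f' v' j a = dep_from f v j a"
        by (auto simp: dep_from_def dep' less')
      moreover have "dep_towards v' k b = dep_towards v k b"
        using ab by (auto simp: dep_towards_def dep')
      ultimately show ?thesis using old by simp
    qed
  qed
  moreover have "initial_conditions R x f' v'"
    unfolding initial_conditions_def
  proof (intro conjI ballI allI impI; (elim conjE)?)
    fix j assume j: "j \<in> edge_trains R x"
    then have "0 < f j" by (rule pos)
    then have "dep v j 0 = 0" using init j by (auto simp: initial_conditions_def)
    with \<open>0 < f j\<close> show "dep v' j 0 = 0" by (auto simp: dep')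
    fix k b
    assume k: "k \<in> trains R" "b < f' k" "k \<noteq> j" and same: "same_track R x j 0 k b"
    show "precedes (z_edge v') j k (path_edge R x j 0)"
    proof (cases "k = i \<and> b = f i")
      case True
      then have "path_edge R x j 0 = e"
        using same_track_imp_eq[OF same] path_e by simp
      with True k show ?thesis by (simp add: edge')
    next
      case False
      then have b: "b < f k" using k by (auto simp: less')
      then have "precedes (z_edge v) j k (path_edge R x j 0)"
        using init j k same \<open>0 < f j\<close> by (auto simp: initial_conditions_def)
      then show ?thesis
        using k \<open>0 < f j\<close> new_edge[of 0] by (auto simp: edge')
    qed
  next
    fix j assume j: "j \<in> node_trains R x"
    then show "z_slot v' j (path_node R x j 0) (the (slot x j))"
      using init by (simp add: slot_old initial_conditions_def)
    fix k b
    assume k: "k \<in> trains R" "k \<noteq> j" "0 < b" "b \<le> f' k" "path_node R x k b = path_node R x j 0"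
    show "precedes (z_node v') j k (path_node R x j 0)"
    proof (cases "k = i \<and> b = Suc (f i)")
      case True
      then have "path_node R x j 0 = n" using k path_n by simp
      with True k show ?thesis by (simp add: node')
    next
      case False
      then have b: "b \<le> f k" using k by (auto simp: le')
      then have "precedes (z_node v) j k (path_node R x j 0)"
        using init[unfolded initial_conditions_def, THEN conjunct2, rule_format, OF j]
          j k b by auto
      then show ?thesis
        using k new_node[of 0] by (auto simp: node')
    qed
  qed
  moreover have "\<forall>j \<in> trains R. \<forall>k < f' j. 0 \<le> dep v' j k"
    using nonneg T0 by (auto simp: dep' less')
  ultimately have "feasible_solution R x f' v'"
    by (simp add: feasible_solution_def)
  then show ?thesis by (auto simp: feasible_def f'_def)
qed

section \<open>Moving all trains between safe terminal states\<close>

text \<open>The trains that stand at \<open>n\<close> when all trains have reached the ends of their truncated paths.\<close>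

definition standing :: "('n, 'e, 'l, 'i) railway \<Rightarrow> ('n, 'l, 'i) state \<Rightarrow> 'i horizon \<Rightarrow> 'n \<Rightarrow> 'i set" where
  "standing R x f n = {i \<in> trains R. path_node R x i (f i) = n}"

text \<open>These trains leave a slot of \<open>n\<close> unoccupied.\<close>

definition has_room :: "('n, 'e, 'l, 'i) railway \<Rightarrow> ('n, 'l, 'i) state \<Rightarrow> 'i horizon \<Rightarrow> 'n \<Rightarrow> bool" where
  "has_room R x f n \<longleftrightarrow> infinite (slots R n) \<or> card (standing R x f n) < card (slots R n)"

lemma feasible_move_train:
  fixes R :: "('n, 'e, 'l, 'i::linorder) railway"
  assumes wf: "wf_railway R" and reg: "regular_state R x" and hor: "is_horizon R x f"
    and pos: "\<And>j. j \<in> edge_trains R x \<Longrightarrow> 0 < f j"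
    and feas: "feasible R x f"
    and i: "i \<in> trains R" and m: "f i \<le> m" "m \<le> full_horizon R x i"
    and room: "\<And>k. f i < k \<Longrightarrow> k \<le> m \<Longrightarrow> has_room R x f (path_node R x i k)"
  shows "feasible R x (f(i := m))"
  using m room
proof (induction m rule: dec_induct)
  case base
  then show ?case using feas by simp
next
  case (step k)
  have fin: "finite (standing R x f n)" for n
    using wf by (simp add: wf_railway_def standing_def)
  let ?f = "f(i := k)" and ?n = "path_node R x i (Suc k)"
  have "has_room R x f ?n" using step by simp
  moreover have "card {j \<in> trains R - {i}. path_node R x j (?f j) = ?n} \<le> card (standing R x f ?n)"
    by (intro card_mono fin) (auto simp: standing_def)
  ultimately have room_n: "infinite (slots R ?n) \<or>
      card {j \<in> trains R - {i}. path_node R x j (?f j) = ?n} < card (slots R ?n)"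
    unfolding has_room_def by linarith
  have hor': "is_horizon R x ?f" using hor step by (auto simp: is_horizon_def)
  have pos': "0 < ?f j" if "j \<in> edge_trains R x" for j
    using pos[OF that] step.hyps(1) by (cases "j = i") auto
  have feas': "feasible R x ?f" by (rule step.IH) (use step.prems in auto)
  have "feasible R x (?f(i := Suc (?f i)))"
    by (rule feasible_advance[OF wf reg hor' pos' feas' i _ _ room_n]) (use step.prems in auto)
  moreover have "?f(i := Suc (?f i)) = f(i := Suc k)" by simp
  ultimately show ?case by (simp only:)
qed

text \<open>The invariant of the successive moves is the last hypothesis: unless all trains are at their
  destinations, some train can be moved such that all nodes other than its own have room. The
  induction is on the number of trains that still have to be moved.\<close>

lemma feasible_extend_aux:
  fixes R :: "('n, 'e, 'l, 'i::linorder) railway"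
  assumes wf: "wf_railway R" and reg: "regular_state R x" and g: "is_horizon R x g"
    and room: "\<And>n. n \<in> nodes R \<Longrightarrow> has_room R x g n"
    and "\<And>i. i \<in> trains R \<Longrightarrow> f i \<le> g i"
    and "\<And>i. i \<in> edge_trains R x \<Longrightarrow> 0 < f i"
    and "feasible R x f"
    and "\<And>n. n \<in> nodes R \<Longrightarrow> finite (slots R n) \<Longrightarrow> card (standing R x f n) \<le> card (slots R n)"
    and "(\<forall>i \<in> trains R. f i = g i) \<or>
      (\<exists>i \<in> trains R. f i < g i \<and> (\<forall>n \<in> nodes R - {path_node R x i (f i)}. has_room R x f n))"
  shows "feasible R x g"
  using assms(5-)
proof (induction "card {i \<in> trains R. f i < g i}" arbitrary: f rule: less_induct)
  case less
  have fin: "finite (trains R)" using wf by (simp add: wf_railway_def)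
  have fin_st: "finite (standing R x h n)" for h n
    using fin by (simp add: standing_def)
  show ?case
  proof (cases "\<forall>i \<in> trains R. f i = g i")
    case True
    then show ?thesis using less.prems(3) by (auto intro: feasible_cong)
  next
    case False
    with less.prems(5) obtain i where i: "i \<in> trains R" "f i < g i"
      and others: "\<And>n. n \<in> nodes R \<Longrightarrow> n \<noteq> path_node R x i (f i) \<Longrightarrow> has_room R x f n"
      by blast
    let ?s = "path_node R x i (f i)" and ?t = "path_node R x i (g i)"
    define f' where "f' = f(i := g i)"
    have gi: "g i \<le> full_horizon R x i" using g i by (simp add: is_horizon_def)
    have hor: "is_horizon R x f"
      using g less.prems(1) by (force simp: is_horizon_def)
    have ne: "path_node R x i k \<noteq> ?s" if "f i < k" "k \<le> g i" for k
      using that gi path_node_inject[OF wf i(1) reg, of k "f i"] by simp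
    have in_nodes: "path_node R x i k \<in> nodes R" if "k \<le> g i" for k
      using that gi by (intro path_node_in_nodes[OF wf i(1) reg]) simp
    have feas': "feasible R x f'"
      unfolding f'_def using i gi ne in_nodes
      by (intro feasible_move_train[OF wf reg hor] less.prems(2,3) others) auto
    have le': "f' j \<le> g j" if "j \<in> trains R" for j
      using less.prems(1) that by (simp add: f'_def)
    have pos': "0 < f' j" if "j \<in> edge_trains R x" for j
      using less.prems(2) that i by (auto simp: f'_def)
    have decr: "card {j \<in> trains R. f' j < g j} < card {j \<in> trains R. f j < g j}"
      using fin i by (intro psubset_card_mono) (auto simp: f'_def)

    have room_s: "finite (slots R ?s) \<Longrightarrow> card (standing R x f' ?s) < card (slots R ?s)"
    proof -
      assume "finite (slots R ?s)"
      then have "card (standing R x f ?s) \<le> card (slots R ?s)"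
        using i by (intro less.prems(4) in_nodes) auto
      moreover have "standing R x f' ?s \<subset> standing R x f ?s"
        using i ne[of "g i"] by (auto simp: standing_def f'_def split: if_splits)
      then have "card (standing R x f' ?s) < card (standing R x f ?s)"
        by (intro psubset_card_mono fin_st)
      ultimately show ?thesis by simp
    qed
    have room': "has_room R x f' n" if "n \<in> nodes R" "n \<noteq> ?t" for n
    proof (cases "n = ?s")
      case True
      then show ?thesis using room_s by (auto simp: has_room_def)
    next
      case False
      have "card (standing R x f' n) \<le> card (standing R x f n)"
        using that by (intro card_mono fin_st) (auto simp: standing_def f'_def split: if_splits)
      then show ?thesis using others[OF that(1) False] by (auto simp: has_room_def)
    qed
    have cap: "card (standing R x f' n) \<le> card (slots R n)"
      if "n \<in> nodes R" "finite (slots R n)" for n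
    proof (cases "n = ?t")
      case True
      have "card (standing R x f' n) \<le> card (insert i (standing R x f n))"
        by (intro card_mono finite.insertI fin_st) (auto simp: standing_def f'_def split: if_splits)
      also have "\<dots> \<le> Suc (card (standing R x f n))"
        by (simp add: card_insert_if fin_st)
      also have "\<dots> \<le> card (slots R n)"
        using others[of n] True that i ne[of "g i"] by (auto simp: has_room_def)
      finally show ?thesis .
    next
      case False
      then show ?thesis using room'[of n] that by (auto simp: has_room_def)
    qed
    \<comment> \<open>Only the destination can be full now. As it has room in the end, it then hosts a train that
      still has to leave, and this train is the next one.\<close>
    have "(\<forall>j \<in> trains R. f' j = g j) \<or>
      (\<exists>j \<in> trains R. f' j < g j \<and> (\<forall>n \<in> nodes R - {path_node R x j (f' j)}. has_room R x f' n))"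
    proof (cases "has_room R x f' ?t")
      case True
      then have "has_room R x f' n" if "n \<in> nodes R" for n using room' that by metis
      then show ?thesis using le' by (metis DiffD1 le_neq_implies_less)
    next
      case False
      have "\<not> standing R x f' ?t \<subseteq> standing R x g ?t"
      proof
        assume "standing R x f' ?t \<subseteq> standing R x g ?t"
        then have "card (standing R x f' ?t) \<le> card (standing R x g ?t)"
          by (intro card_mono fin_st)
        with False room[of ?t] in_nodes[of "g i"] show False by (auto simp: has_room_def)
      qed
      then obtain j where "j \<in> trains R" "path_node R x j (f' j) = ?t" "f' j \<noteq> g j"
        by (auto simp: standing_def) metis
      then show ?thesis using le'[of j] room' by (intro disjI2 bexI[of _ j]) auto
    qed
    with decr le' pos' feas' cap show ?thesis by (intro less.hyps[of f']) auto
  qed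
qed

lemma feasible_extend:
  fixes R :: "('n, 'e, 'l, 'i::linorder) railway"
  assumes wf: "wf_railway R" and reg: "regular_state R x" and g: "is_horizon R x g"
    and room_f: "\<And>n. n \<in> nodes R \<Longrightarrow> has_room R x f n"
    and room_g: "\<And>n. n \<in> nodes R \<Longrightarrow> has_room R x g n"
    and le: "\<And>i. i \<in> trains R \<Longrightarrow> f i \<le> g i"
    and pos: "\<And>i. i \<in> edge_trains R x \<Longrightarrow> 0 < f i"
    and feas: "feasible R x f"
  shows "feasible R x g"
proof (rule feasible_extend_aux[OF wf reg g room_g le pos feas])
  show "card (standing R x f n) \<le> card (slots R n)" if "n \<in> nodes R" "finite (slots R n)" for n
    using room_f[OF that(1)] that(2) by (auto simp: has_room_def)
  show "(\<forall>i \<in> trains R. f i = g i) \<or>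
      (\<exists>i \<in> trains R. f i < g i \<and> (\<forall>n \<in> nodes R - {path_node R x i (f i)}. has_room R x f n))"
    using le room_f by (metis DiffD1 le_neq_implies_less)
qed

lemma has_room_full_horizon:
  assumes wf: "wf_railway R" and reg: "regular_state R x" and n: "n \<in> nodes R"
  shows "has_room R x (full_horizon R x) n"
proof (cases "standing R x (full_horizon R x) n = {}")
  case True
  have "slots R n \<noteq> {}" using wf n by (auto simp: wf_railway_def)
  with True show ?thesis by (auto simp: has_room_def card_gt_0_iff)
next
  case False
  then show ?thesis
    using path_node_full_horizon[OF wf _ reg] route_facts(6)[OF wf]
    by (auto simp: has_room_def standing_def)
qed

lemma safe_terminal_state_has_room:
  assumes wf: "wf_railway R" and safe: "safe_terminal_state R x f" and n: "n \<in> nodes R"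
  shows "has_room R x f n"
proof -
  obtain x' where adm: "admissible R x'" and safe': "safe_state R x'"
    and last: "\<And>i. i \<in> trains R \<Longrightarrow> last_node x' i = path_node R x i (f i)"
    using safe by (auto simp: safe_terminal_state_def)
  have reg: "regular_state R x'" by (rule admissible_imp_regular_state[OF adm])
  have nt: "i \<in> node_trains R x' \<and> i \<notin> edge_trains R x'" if "i \<in> trains R" for i
    using safe' that by (auto simp: safe_state_def node_trains_def edge_trains_def)
  have held: "path_node R x' i 0 = path_node R x i (f i)" if "i \<in> trains R" for i
    using position_facts(2)[OF wf that reg] last[OF that] by (simp add: path_node_def)
  obtain s where s: "\<forall>i \<in> node_trains R x'. slot x' i = Some (s i)"
    "\<forall>i \<in> trains R. s i \<in> slots R (path_node R x' i (if i \<in> edge_trains R x' then 1 else 0))"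
    "\<forall>i \<in> trains R. \<forall>j \<in> trains R. i \<noteq> j \<and>
       path_node R x' i (if i \<in> edge_trains R x' then 1 else 0) =
       path_node R x' j (if j \<in> edge_trains R x' then 1 else 0) \<longrightarrow> s i \<noteq> s j"
    using adm unfolding admissible_def Let_def by blast
  obtain l where l: "l \<in> slots R n" "\<not> (\<exists>i \<in> trains R. last_node x' i = n \<and> slot x' i = Some l)"
    using safe' n by (auto simp: safe_state_def)
  have "card (standing R x f n) < card (slots R n)" if fin: "finite (slots R n)"
  proof -
    have "s i \<noteq> s j"
      if "i \<in> trains R" "j \<in> trains R" "i \<noteq> j" "path_node R x i (f i) = path_node R x j (f j)" for i j
      using s(3)[rule_format, of i j] nt held that by simp
    then have "inj_on s (standing R x f n)"
      unfolding inj_on_def standing_def by (metis (mono_tags, lifting) mem_Collect_eq)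
    moreover have "s ` standing R x f n \<subseteq> slots R n - {l}"
      using s(1,2) nt held l last by (auto simp: standing_def)
    ultimately have "card (standing R x f n) \<le> card (slots R n - {l})"
      using fin by (metis card_inj_on_le finite_Diff)
    also have "\<dots> < card (slots R n)" using fin l(1) by (rule card_Diff1_less)
    finally show ?thesis .
  qed
  then show ?thesis by (auto simp: has_room_def)
qed

section \<open>The horizon-computation procedure\<close>

text \<open>The invariant is that \<open>\<eta>\<close> is positive everywhere. At the terminal of a train it is infinite, so
  that the search stops there at the latest.\<close>

lemma settle_facts:
  fixes R :: "('n, 'e, 'l, 'i) railway"
  assumes wf: "wf_railway R" and reg: "regular_state R x" and "settle R x is \<eta> f g"
    and "distinct is" "set is \<subseteq> trains R" "\<forall>i \<in> set is. f i \<le> full_horizon R x i"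
    and "\<forall>i \<in> set is. \<eta> (last (route R i)) = \<infinity>" "\<forall>n \<in> nodes R. 1 \<le> \<eta> n"
  shows "(\<forall>n \<in> nodes R. enat (card {i \<in> set is. path_node R x i (g i) = n}) + 1 \<le> \<eta> n) \<and>
    (\<forall>i \<in> set is. f i \<le> g i \<and> g i \<le> full_horizon R x i) \<and> (\<forall>i. i \<notin> set is \<longrightarrow> g i = f i)"
  using assms(3-)
proof (induction rule: settle.induct)
  case (finished \<eta> f)
  then show ?case by (simp add: zero_enat_def[symmetric])
next
  case (advance \<eta> i f "is" g)
  have i: "i \<in> trains R" using advance.prems by simp
  have "f i \<noteq> full_horizon R x i"
  proof
    assume "f i = full_horizon R x i"
    then have "\<eta> (path_node R x i (f i)) = \<infinity>"
      using advance.prems path_node_full_horizon[OF wf i reg] by simp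
    with advance.hyps(1) show False by simp
  qed
  with advance.prems have "Suc (f i) \<le> full_horizon R x i"
    by (simp add: le_neq_implies_less Suc_leI)
  with advance.prems have "\<forall>j \<in> set (i # is). (f(i := f i + 1)) j \<le> full_horizon R x j" by simp
  with advance.IH advance.prems show ?case by (force split: if_splits)
next
  case (stop \<eta> i f n "is" g)
  have i: "i \<in> trains R" "i \<notin> set is" using stop.prems by auto
  have n: "n \<in> nodes R"
    using stop.hyps(2) stop.prems path_node_in_nodes[OF wf i(1) reg] by simp
  have gt: "1 < \<eta> n" using stop.hyps by simp
  then have dec: "1 \<le> \<eta> n - 1" "\<eta> n - 1 + 1 = \<eta> n"
    by (cases "\<eta> n"; simp add: one_enat_def)+
  let ?\<eta> = "\<eta>(n := \<eta> n - 1)"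
  have "\<forall>j \<in> set is. ?\<eta> (last (route R j)) = \<infinity>"
    using stop.prems by (auto simp: idiff_infinity)
  moreover have "\<forall>n \<in> nodes R. 1 \<le> ?\<eta> n" using stop.prems dec by simp
  ultimately have IH: "\<forall>m \<in> nodes R. enat (card {i \<in> set is. path_node R x i (g i) = m}) + 1 \<le> ?\<eta> m"
    "\<forall>i \<in> set is. f i \<le> g i \<and> g i \<le> full_horizon R x i" "\<forall>i. i \<notin> set is \<longrightarrow> g i = f i"
    using stop.IH stop.prems by simp_all
  have gi: "g i = f i" using IH(3) i by simp
  have "enat (card {j \<in> set (i # is). path_node R x j (g j) = m}) + 1 \<le> \<eta> m"
    if m: "m \<in> nodes R" for m
  proof (cases "m = n")
    case True
    have "{j \<in> set (i # is). path_node R x j (g j) = m} =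
        insert i {j \<in> set is. path_node R x j (g j) = m}"
      using True gi stop.hyps(2) by auto
    then have "card {j \<in> set (i # is). path_node R x j (g j) = m} =
        card {j \<in> set is. path_node R x j (g j) = m} + 1"
      using i by simp
    moreover have "enat (card {j \<in> set is. path_node R x j (g j) = m}) + 1 + 1 \<le> \<eta> n - 1 + 1"
      using IH(1) n True by (intro add_right_mono) auto
    ultimately show ?thesis using True dec by (simp add: one_enat_def)
  next
    case False
    then have "{j \<in> set (i # is). path_node R x j (g j) = m} =
        {j \<in> set is. path_node R x j (g j) = m}"
      using gi stop.hyps(2) by auto
    then show ?thesis using IH(1) m False by auto
  qed
  with IH gi stop.prems show ?case by auto
qed

lemma settled_facts:
  fixes R :: "('n, 'e, 'l, 'i) railway"
  assumes wf: "wf_railway R" and reg: "regular_state R x"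
    and settled: "settled R x f g" and hor: "is_horizon R x f"
  shows "is_horizon R x g" "i \<in> trains R \<Longrightarrow> f i \<le> g i" "n \<in> nodes R \<Longrightarrow> has_room R x g n"
proof -
  obtain "is" where "is": "distinct is" "set is = trains R" "settle R x is (num_slots R) f g"
    using settled by (auto simp: settled_def)
  have "1 \<le> num_slots R n" if "n \<in> nodes R" for n
    using wf that by (auto simp: wf_railway_def num_slots_def one_enat_def Suc_le_eq card_gt_0_iff)
  moreover have "num_slots R (last (route R i)) = \<infinity>" if "i \<in> trains R" for i
    using route_facts(6)[OF wf that] by (simp add: num_slots_def)
  ultimately have *:
    "\<forall>n \<in> nodes R. enat (card {i \<in> set is. path_node R x i (g i) = n}) + 1 \<le> num_slots R n"
    "\<forall>i \<in> set is. f i \<le> g i \<and> g i \<le> full_horizon R x i"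
    using settle_facts[OF wf reg "is"(3,1)] "is"(2) hor by (auto simp: is_horizon_def)
  show "is_horizon R x g" "i \<in> trains R \<Longrightarrow> f i \<le> g i"
    using *(2) "is"(2) by (auto simp: is_horizon_def)
  show "has_room R x g n" if "n \<in> nodes R"
    using *(1) that "is"(2)
    by (auto simp: has_room_def standing_def num_slots_def one_enat_def Suc_le_eq)
qed

lemma returns_facts:
  fixes R :: "('n, 'e, 'l, 'i::linorder) railway"
  assumes wf: "wf_railway R" and reg: "regular_state R x"
    and "returns R x f h" "is_horizon R x f"
  shows "is_horizon R x h \<and> (\<forall>i \<in> trains R. f i \<le> h i) \<and> (\<forall>n \<in> nodes R. has_room R x h n) \<and>
    (feasible R x h \<or> (\<forall>i \<in> trains R. h i = full_horizon R x i))"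
  using assms(3-)
proof (induction rule: returns.induct)
  case (success f g)
  then show ?case using settled_facts[OF wf reg] by blast
next
  case (extend f g i h)
  note g = settled_facts[OF wf reg extend.hyps(1) extend.prems]
  then have "is_horizon R x (g(i := g i + 1))"
    using extend.hyps(4) by (auto simp: is_horizon_def)
  note IH = extend.IH[OF this]
  then have "f j \<le> h j" if "j \<in> trains R" for j
    using g(2)[OF that] that by (metis fun_upd_apply le_trans le_add1)
  with IH show ?case by blast
next
  case (exhausted f g)
  note g = settled_facts[OF wf reg exhausted.hyps(1) exhausted.prems]
  then have "\<forall>i \<in> trains R. g i = full_horizon R x i"
    using exhausted.hyps(3) by (force simp: is_horizon_def)
  with g show ?case by blast
qed

section \<open>Closed-loop operation\<close>

text \<open>The precedence variables \<open>z\<close>, changed so that at \<open>a\<close> the trains with property \<open>P\<close> come before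
  those without it.\<close>

definition put_first :: "('i \<Rightarrow> 'a \<Rightarrow> bool) \<Rightarrow> ('i \<Rightarrow> 'i \<Rightarrow> 'a \<Rightarrow> bool) \<Rightarrow> 'i \<Rightarrow> 'i \<Rightarrow> 'a \<Rightarrow> bool" where
  "put_first P z i j a \<longleftrightarrow> (if P i a \<noteq> P j a then P i a else z i j a)"

lemma precedes_put_first:
  "i \<noteq> j \<Longrightarrow> precedes (put_first P z) i j a \<longleftrightarrow> (if P i a \<noteq> P j a then P i a else precedes z i j a)"
  by (auto simp: precedes_def put_first_def)

lemma dep_mono:
  fixes R :: "('n, 'e, 'l, 'i) railway"
  assumes wf: "wf_railway R" and reg: "regular_state R x" and hor: "is_horizon R x f"
    and seq: "sequentiality R x f v" and i: "i \<in> trains R" and "a \<le> b" "b < f i"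
  shows "dep v i a \<le> dep v i b"
  using assms(6,7)
proof (induction b rule: dec_induct)
  case (step b)
  have "b < full_horizon R x i" using step hor i by (auto simp: is_horizon_def)
  then have "0 \<le> remaining_time R x i b" by (rule remaining_time_bounds(1)[OF wf i reg])
  moreover have "dep v i b + remaining_time R x i b \<le> dep v i (Suc b)"
    using seq i step by (force simp: sequentiality_def)
  ultimately show ?case using step by simp
qed simp

text \<open>After the operation for a time \<open>\<Delta>\<close> a train is at the node with index \<open>p\<close> of its old remaining path,
  or it is transiting the edge with index \<open>p\<close>.\<close>

definition operated_to_node ::
  "('n, 'e, 'l, 'i) railway \<Rightarrow> ('n, 'l, 'i) state \<Rightarrow> 'i horizon \<Rightarrow> ('n, 'e, 'l, 'i) variables
    \<Rightarrow> real \<Rightarrow> ('n, 'l, 'i) state \<Rightarrow> 'i \<Rightarrow> nat \<Rightarrow> bool" where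
  "operated_to_node R x f v \<Delta> x' i p \<longleftrightarrow> p \<le> f i \<and> visits R x f i p \<and>
     last_node x' i = path_node R x i p \<and> fraction x' i = 0 \<and>
     (\<exists>l. slot x' i = Some l \<and> z_slot v i (path_node R x i p) l) \<and>
     (p < f i \<longrightarrow> \<Delta> \<le> dep v i p) \<and> (0 < p \<longrightarrow> dep v i (p - 1) < \<Delta>)"

definition operated_to_edge ::
  "('n, 'e, 'l, 'i) railway \<Rightarrow> ('n, 'l, 'i) state \<Rightarrow> 'i horizon \<Rightarrow> ('n, 'e, 'l, 'i) variables
    \<Rightarrow> real \<Rightarrow> ('n, 'l, 'i) state \<Rightarrow> 'i \<Rightarrow> nat \<Rightarrow> bool" where
  "operated_to_edge R x f v \<Delta> x' i p \<longleftrightarrow> p < f i \<and>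
     last_node x' i = path_node R x i p \<and> slot x' i = None \<and>
     0 \<le> fraction x' i \<and> fraction x' i \<le> 1 \<and>
     travel_time R i (path_edge R x i p) * (1 - fraction x' i) = dep v i p + remaining_time R x i p - \<Delta> \<and>
     dep v i p < \<Delta> \<and> \<Delta> < dep v i p + remaining_time R x i p"

lemma operates_to_cases:
  fixes R :: "('n, 'e, 'l, 'i::linorder) railway"
  assumes wf: "wf_railway R" and reg: "regular_state R x" and hor: "is_horizon R x f"
    and pos: "\<And>j. j \<in> edge_trains R x \<Longrightarrow> 0 < f j"
    and v: "feasible_solution R x f v" and op: "operates_to R x f v \<Delta> x'" and \<Delta>: "0 < \<Delta>"
    and i: "i \<in> trains R"
  obtains p where "operated_to_node R x f v \<Delta> x' i p" | p where "operated_to_edge R x f v \<Delta> x' i p"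
proof -
  have init: "initial_conditions R x f v" using v by (simp add: feasible_solution_def)
  have f_le: "f i \<le> full_horizon R x i" using hor i by (simp add: is_horizon_def)
  have kinds: "i \<in> node_trains R x \<and> slot x i \<noteq> None \<or> i \<in> edge_trains R x \<and> slot x i = None"
    using i by (auto simp: node_trains_def edge_trains_def)
  have dep0: "dep v i 0 = 0" if "i \<in> edge_trains R x"
    using init pos that by (simp add: initial_conditions_def)
  consider (stay) "f i = 0 \<or> \<Delta> \<le> dep v i 0" "last_node x' i = last_node x i"
      "fraction x' i = fraction x i" "slot x' i = slot x i"
    | (edge) k where "k < f i" "dep v i k < \<Delta>" "\<Delta> < dep v i k + remaining_time R x i k"
      "last_node x' i = path_node R x i k"
      "fraction x' i = (if k = 0 then fraction x i else 0)
          + (\<Delta> - dep v i k) / travel_time R i (path_edge R x i k)"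
      "slot x' i = None"
    | (node) k l where "k < f i" "dep v i k + remaining_time R x i k \<le> \<Delta>"
      "k + 1 < f i \<longrightarrow> \<Delta> \<le> dep v i (k + 1)"
      "last_node x' i = path_node R x i (k + 1)" "fraction x' i = 0"
      "z_slot v i (path_node R x i (k + 1)) l" "slot x' i = Some l"
    using op i unfolding operates_to_def by blast
  then show thesis
  proof cases
    case stay
    have i_node: "i \<in> node_trains R x"
      using stay(1) kinds dep0 pos[of i] \<Delta> by auto
    then obtain l where l: "slot x i = Some l" by (auto simp: node_trains_def)
    have "z_slot v i (path_node R x i 0) l"
      using init i_node l by (force simp: initial_conditions_def)
    moreover have "path_node R x i 0 = last_node x i"
      using position_facts(2)[OF wf i reg] by (simp add: path_node_def)
    moreover have "fraction x i = 0"
      using reg i l by (simp add: regular_state_def)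
    ultimately have "operated_to_node R x f v \<Delta> x' i 0"
      using stay l i_node by (auto simp: operated_to_node_def visits_def)
    then show thesis by (rule that(1))
  next
    case (edge k)
    let ?t = "travel_time R i (path_edge R x i k)" and ?fr = "if k = 0 then fraction x i else 0"
    have t: "0 < ?t" using edge f_le by (intro travel_time_pos[OF wf i reg]) simp
    have fr: "0 \<le> ?fr" using reg i by (simp add: regular_state_def)
    have rem: "remaining_time R x i k = ?t * (1 - ?fr)" by (simp add: remaining_time_def)
    have eq: "?t * (1 - fraction x' i) = dep v i k + remaining_time R x i k - \<Delta>"
      unfolding edge(5) rem using t by (simp add: field_simps)
    with edge(3) have "0 < ?t * (1 - fraction x' i)" by simp
    then have "fraction x' i \<le> 1" using t by (simp add: zero_less_mult_iff)
    moreover have "0 \<le> fraction x' i"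
      unfolding edge(5) using t fr edge(2) by (intro add_nonneg_nonneg) auto
    ultimately have "operated_to_edge R x f v \<Delta> x' i k"
      using edge eq by (simp add: operated_to_edge_def)
    then show thesis by (rule that(2))
  next
    case (node k l)
    have k: "k < full_horizon R x i" using node f_le by simp
    \<comment> \<open>The remaining time is zero if the train had already traversed the whole of its first edge;
      it then departed at time \<open>0\<close>, which is before \<open>\<Delta>\<close>.\<close>
    have "dep v i k < \<Delta>"
    proof (cases "k \<noteq> 0 \<or> i \<in> node_trains R x")
      case True
      then show ?thesis
        using node(2) remaining_time_bounds(3)[OF wf i reg k] travel_time_pos[OF wf i reg k] by simp
    next
      case False
      then show ?thesis using kinds dep0 \<Delta> by auto
    qed
    then have "operated_to_node R x f v \<Delta> x' i (k + 1)"
      using node by (auto simp: operated_to_node_def visits_def)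
    then show thesis by (rule that(1))
  qed
qed

text \<open>The horizon \<open>f'\<close> ends at the same nodes as \<open>f\<close>.\<close>

lemma feasible_after_operation:
  fixes R :: "('n, 'e, 'l, 'i::linorder) railway"
  assumes wf: "wf_railway R" and reg: "regular_state R x" and hor: "is_horizon R x f"
    and pos: "\<And>j. j \<in> edge_trains R x \<Longrightarrow> 0 < f j"
    and v: "feasible_solution R x f v" and op: "operates_to R x f v \<Delta> x'" and \<Delta>: "0 < \<Delta>"
  shows "regular_state R x' \<and> (\<exists>f'. is_horizon R x' f' \<and> feasible R x' f' \<and>
    (\<forall>i \<in> trains R. position R x' i + f' i = position R x i + f i) \<and>
    (\<forall>i \<in> edge_trains R x'. 0 < f' i))"
proof -
  have nonneg: "\<And>j k. j \<in> trains R \<Longrightarrow> k < f j \<Longrightarrow> 0 \<le> dep v j k"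
    and seq: "sequentiality R x f v" and edge: "edge_conflicts R x f v"
    and node: "node_conflicts R x f v" and init: "initial_conditions R x f v"
    using v by (auto simp: feasible_solution_def)
  have fin: "finite (trains R)" using wf by (simp add: wf_railway_def)
  have f_le: "f j \<le> full_horizon R x j" if "j \<in> trains R" for j
    using hor that by (simp add: is_horizon_def)
  have "\<forall>i \<in> trains R. \<exists>p. operated_to_node R x f v \<Delta> x' i p \<or> operated_to_edge R x f v \<Delta> x' i p"
    using operates_to_cases[OF wf reg hor pos v op \<Delta>] by metis
  then obtain p where p: "\<And>i. i \<in> trains R \<Longrightarrow>
      operated_to_node R x f v \<Delta> x' i (p i) \<or> operated_to_edge R x f v \<Delta> x' i (p i)"
    by metis
  have p_node: "operated_to_node R x f v \<Delta> x' i (p i)" if "i \<in> node_trains R x'" for i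
    using p[of i] that by (auto simp: node_trains_def operated_to_edge_def)
  have p_edge: "operated_to_edge R x f v \<Delta> x' i (p i)" if "i \<in> edge_trains R x'" for i
    using p[of i] that by (auto simp: edge_trains_def operated_to_node_def)
  have node_sub: "j \<in> trains R" if "j \<in> node_trains R x'" for j
    using that by (simp add: node_trains_def)
  have edge_sub: "j \<in> trains R" if "j \<in> edge_trains R x'" for j
    using that by (simp add: edge_trains_def)
  have kinds: "i \<in> node_trains R x' \<and> i \<notin> edge_trains R x' \<or>
      i \<in> edge_trains R x' \<and> i \<notin> node_trains R x'" if "i \<in> trains R" for i
    using that by (auto simp: node_trains_def edge_trains_def)
  have p_le: "p i \<le> f i" "p i \<le> full_horizon R x i" if "i \<in> trains R" for i
    using p[OF that] f_le[OF that] by (auto simp: operated_to_node_def operated_to_edge_def)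

  have position': "position R x' i = position R x i + p i" if i: "i \<in> trains R" for i
  proof (rule position_eqI)
    show "distinct (route R i)" by (rule route_facts[OF wf i])
    show "position R x i + p i < length (route R i)"
      using p_le[OF i] position_add_full_horizon[OF wf i reg] route_facts(3)[OF wf i] by simp
    show "route R i ! (position R x i + p i) = last_node x' i"
      using p[OF i] by (auto simp: path_node_def operated_to_node_def operated_to_edge_def)
  qed
  have path_node': "path_node R x' i k = path_node R x i (p i + k)" if "i \<in> trains R" for i k
    using position'[OF that] by (simp add: path_node_def add.assoc)
  have path_edge': "path_edge R x' i k = path_edge R x i (p i + k)" if "i \<in> trains R" for i k
    using position'[OF that] by (simp add: path_edge_def add.assoc)
  have full': "full_horizon R x' i = full_horizon R x i - p i" if "i \<in> trains R" for i
    using position'[OF that] by (simp add: full_horizon_def)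
  have reg': "regular_state R x'"
    unfolding regular_state_def
  proof
    fix i assume i: "i \<in> trains R"
    have "last_node x' i = route R i ! (position R x i + p i)"
      using p[OF i] by (auto simp: path_node_def operated_to_node_def operated_to_edge_def)
    then have "last_node x' i \<in> set (route R i)"
      using p_le[OF i] position_add_full_horizon[OF wf i reg] route_facts(3)[OF wf i] by simp
    then show "last_node x' i \<in> set (route R i) \<and> 0 \<le> fraction x' i \<and> fraction x' i \<le> 1 \<and>
        (slot x' i \<noteq> None \<longrightarrow> fraction x' i = 0)"
      using p[OF i] by (auto simp: operated_to_node_def operated_to_edge_def)
  qed

  define f' where "f' = (\<lambda>i. f i - p i)"
  have less': "k < f' i \<longleftrightarrow> p i + k < f i" for i k by (auto simp: f'_def)
  have le': "k \<le> f' i \<longleftrightarrow> p i + k \<le> f i" if "i \<in> trains R" for i k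
    using p_le(1)[OF that] by (auto simp: f'_def)
  have pos': "0 < f' i" if "i \<in> edge_trains R x'" for i
    using p_edge[OF that] by (simp add: f'_def operated_to_edge_def)
  have hor': "is_horizon R x' f'"
    using f_le by (auto simp: is_horizon_def f'_def full' intro: diff_le_mono)

  \<comment> \<open>Of the departures from index \<open>p i\<close> on, only the first one of a train now in transit is in
    the past.\<close>
  have later: "\<Delta> \<le> dep v i (p i + k)"
    if i: "i \<in> trains R" and k: "p i + k < f i" and "i \<in> edge_trains R x' \<Longrightarrow> k \<noteq> 0" for i k
  proof (cases "i \<in> edge_trains R x'")
    case True
    then have "k \<noteq> 0" using that(3) by simp
    have "\<Delta> \<le> dep v i (p i) + remaining_time R x i (p i)"
      using p_edge[OF True] by (simp add: operated_to_edge_def)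
    also have "\<dots> \<le> dep v i (Suc (p i))"
      using seq i k \<open>k \<noteq> 0\<close> by (force simp: sequentiality_def)
    also have "\<dots> \<le> dep v i (p i + k)"
      using \<open>k \<noteq> 0\<close> k by (intro dep_mono[OF wf reg hor seq i]) auto
    finally show ?thesis .
  next
    case False
    then have "\<Delta> \<le> dep v i (p i)"
      using p_node[of i] kinds[OF i] k by (simp add: operated_to_node_def)
    also have "\<dots> \<le> dep v i (p i + k)"
      using k by (intro dep_mono[OF wf reg hor seq i]) auto
    finally show ?thesis .
  qed
  have in_transit: "dep v i (p i) < \<Delta>" "\<Delta> < dep v i (p i) + travel_time R i (path_edge R x i (p i))"
    if "i \<in> edge_trains R x'" for i
  proof -
    have "p i < full_horizon R x i"
      using p_edge[OF that] f_le[OF edge_sub[OF that]] by (simp add: operated_to_edge_def)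
    with p_edge[OF that] remaining_time_bounds(2)[OF wf edge_sub[OF that] reg, of "p i"]
    show "dep v i (p i) < \<Delta>" "\<Delta> < dep v i (p i) + travel_time R i (path_edge R x i (p i))"
      by (auto simp: operated_to_edge_def)
  qed
  have arrived: "dep v i (p i - 1) < \<Delta>" if "i \<in> node_trains R x'" "0 < p i" for i
    using p_node[OF that(1)] that(2) by (simp add: operated_to_node_def)

  obtain C where C: "0 \<le> C"
    "\<And>i. i \<in> trains R \<Longrightarrow> travel_time R i (path_edge R x i (p i)) \<le> C"
  proof -
    let ?S = "insert 0 ((\<lambda>i. travel_time R i (path_edge R x i (p i))) ` trains R)"
    have "bdd_above ?S" using fin by (intro bdd_above_finite) auto
    then obtain C where "\<And>q. q \<in> ?S \<Longrightarrow> q \<le> C" unfolding bdd_above_def by blast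
    then show ?thesis by (intro that[of C]) auto
  qed

  \<comment> \<open>The solution may order trains arbitrarily at a node where they use different slots. Trains that
    now stand at a node must go first there, which only changes the order of such pairs.\<close>
  define stands where "stands = (\<lambda>i n. i \<in> node_trains R x' \<and> path_node R x' i 0 = n)"
  define v' where "v' = v\<lparr>
      dep := (\<lambda>i k. if i \<in> edge_trains R x' \<and> k = 0 then 0 else dep v i (p i + k) - \<Delta> + C),
      z_node := put_first stands (z_node v)\<rparr>"
  have dep': "dep v' i k =
      (if i \<in> edge_trains R x' \<and> k = 0 then 0 else dep v i (p i + k) - \<Delta> + C)" for i k
    by (simp add: v'_def)
  have same': "z_edge v' = z_edge v" "z_slot v' = z_slot v" by (simp_all add: v'_def)
  have node': "precedes (z_node v') i j n \<longleftrightarrow>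
      (if stands i n \<noteq> stands j n then stands i n else precedes (z_node v) i j n)" if "i \<noteq> j" for i j n
    using that by (simp add: v'_def precedes_put_first)
  have visits': "visits R x f i (p i + k)" if "i \<in> trains R" "visits R x' f' i k" for i k
    using that p_node[of i] by (auto simp: visits_def le' operated_to_node_def)
  have same_track': "same_track R x' i a j b \<longleftrightarrow> same_track R x i (p i + a) j (p j + b)"
    if "i \<in> trains R" "j \<in> trains R" for i j a b
    using that by (simp add: same_track_def path_node' path_edge')

  \<comment> \<open>On a common edge the second train departs in the future, so the delay by \<open>C\<close> applies to it.\<close>
  have edge_later: "\<Delta> < dep v j (p j + b) \<and>
      dep v i (p i + a) + travel_time R i (path_edge R x' i a) \<le> dep v j (p j + b)"
    if *: "i \<in> trains R" "j \<in> trains R" "a < f' i" "b < f' j" "i \<noteq> j" "same_track R x' i a j b"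
      "precedes (z_edge v) i j (path_edge R x' i a)" for i j a b
  proof -
    have old: "dep v i (p i + a) + travel_time R i (path_edge R x' i a) \<le> dep v j (p j + b)"
      using edge[unfolded edge_conflicts_iff, rule_format, of i j "p i + a" "p j + b"] *
      by (simp add: same_track' less' path_edge')
    have "a < full_horizon R x' i" using hor' * by (auto simp: is_horizon_def)
    then have "0 < travel_time R i (path_edge R x' i a)"
      by (rule travel_time_pos[OF wf *(1) reg'])
    then have "\<Delta> < dep v i (p i + a) + travel_time R i (path_edge R x' i a)"
      using later[of i a] in_transit(2)[of i] * by (cases "i \<in> edge_trains R x' \<and> a = 0")
        (auto simp: less' path_edge')
    with old show ?thesis by simp
  qed
  \<comment> \<open>In a common slot the second train has not yet arrived, since the first one has not yet left.\<close>
  have node_later: "b \<noteq> 0 \<and> dep_from f' v' i a \<le> dep_towards v' j b"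
    if *: "i \<in> trains R" "j \<in> trains R" "i \<noteq> j" "visits R x' f' i a" "visits R x' f' j b"
      "path_node R x' i a = n" "path_node R x' j b = n" "l \<in> slots R n"
      "z_slot v i n l" "z_slot v j n l" "precedes (z_node v) i j n" for i j a b n l
  proof -
    have "dep_from f v i (p i + a) \<le> dep_towards v j (p j + b)"
      using node[unfolded node_conflicts_iff, THEN conjunct2, rule_format, of i j l "p i + a" "p j + b"]
        * visits'[OF *(1,4)] visits'[OF *(2,5)] by (simp add: path_node')
    then have a: "p i + a < f i" and b: "0 < p j + b"
      and le: "dep v i (p i + a) \<le> dep v j (p j + b - 1)"
      by (auto simp: dep_from_def dep_towards_def split: if_splits)
    have i_a: "\<not> (i \<in> edge_trains R x' \<and> a = 0)"
      using *(4) kinds[OF *(1)] by (auto simp: visits_def)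
    then have "\<Delta> \<le> dep v i (p i + a)" using a *(1) by (intro later) auto
    with le have late: "\<Delta> \<le> dep v j (p j + b - 1)" by simp
    have "b \<noteq> 0"
    proof
      assume "b = 0"
      then show False using late arrived[of j] b *(5) by (auto simp: visits_def)
    qed
    moreover have "\<not> (j \<in> edge_trains R x' \<and> b - 1 = 0)"
    proof
      assume "j \<in> edge_trains R x' \<and> b - 1 = 0"
      with \<open>b \<noteq> 0\<close> have "b = 1" "j \<in> edge_trains R x'" by auto
      then show False using late in_transit(1)[of j] by simp
    qed
    ultimately show ?thesis
      using i_a a le by (cases b) (auto simp: dep_from_def dep_towards_def dep' less')
  qed

  have "sequentiality R x' f' v'"
    unfolding sequentiality_def
  proof (intro ballI allI impI, elim conjE)
    fix i k assume i: "i \<in> trains R" and k: "1 \<le> k" "k < f' i"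
    have old: "dep v i (p i + (k - 1)) + remaining_time R x i (p i + (k - 1)) \<le> dep v i (p i + k)"
      using seq[unfolded sequentiality_def, rule_format, OF i, of "p i + k"] k by (simp add: less')
    show "dep v' i (k - 1) + remaining_time R x' i (k - 1) \<le> dep v' i k"
    proof (cases "i \<in> edge_trains R x' \<and> k - 1 = 0")
      case True
      then have "remaining_time R x' i 0 = dep v i (p i) + remaining_time R x i (p i) - \<Delta>"
        using p_edge[of i] by (simp add: remaining_time_def path_edge' i operated_to_edge_def)
      with True k old C(1) show ?thesis by (simp add: dep')
    next
      case False
      have kF: "k - 1 < full_horizon R x' i" "p i + (k - 1) < full_horizon R x i"
        using k f_le[OF i] by (auto simp: less' full'[OF i] f'_def)
      have "remaining_time R x' i (k - 1) = travel_time R i (path_edge R x' i (k - 1))"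
        using False kinds[OF i] by (intro remaining_time_bounds(3)[OF wf i reg' kF(1)]) auto
      moreover have "remaining_time R x i (p i + (k - 1)) =
          travel_time R i (path_edge R x i (p i + (k - 1)))"
        using False kinds[OF i] p_node[of i]
        by (intro remaining_time_bounds(3)[OF wf i reg kF(2)])
          (auto simp: operated_to_node_def visits_def)
      ultimately show ?thesis
        using False k old by (auto simp: dep' path_edge' i)
    qed
  qed
  moreover have "edge_conflicts R x' f' v'"
    unfolding edge_conflicts_iff
  proof (intro ballI allI impI, elim conjE)
    fix i j a b
    assume *: "i \<in> trains R" "j \<in> trains R" "a < f' i" "b < f' j" "i \<noteq> j"
      "same_track R x' i a j b" "precedes (z_edge v') i j (path_edge R x' i a)"
    note ** = edge_later[OF *(1-6) *(7)[unfolded same']]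
    then have "\<not> (j \<in> edge_trains R x' \<and> b = 0)"
      using in_transit(1)[of j] by (cases "b = 0") auto
    with ** C(1) C(2)[OF *(1)]
    show "dep v' i a + travel_time R i (path_edge R x' i a) \<le> dep v' j b"
      by (auto simp: dep' path_edge' *(1))
  qed
  moreover have "node_conflicts R x' f' v'"
    unfolding node_conflicts_iff slot_assignment_def
  proof (intro conjI ballI allI impI; (elim conjE)?)
    fix i k assume i: "i \<in> trains R" and k: "visits R x' f' i k"
    show "\<exists>!l. l \<in> slots R (path_node R x' i k) \<and> z_slot v' i (path_node R x' i k) l"
      using node[unfolded node_conflicts_def, THEN conjunct1, rule_format, OF i visits'[OF i k]]
      by (simp add: same' path_node' i)
  next
    fix i j a b l
    let ?n = "path_node R x' i a"
    assume *: "i \<in> trains R" "j \<in> trains R" "l \<in> slots R ?n" "i \<noteq> j" "visits R x' f' i a"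
      "visits R x' f' j b" "path_node R x' j b = ?n" "z_slot v' i ?n l" "z_slot v' j ?n l"
      "precedes (z_node v') i j ?n"
    have "precedes (z_node v) i j ?n"
    proof (rule ccontr)
      assume not: "\<not> precedes (z_node v) i j ?n"
      then have "stands i ?n" using * by (auto simp: node' split: if_splits)
      moreover have "a \<le> full_horizon R x' i"
        using *(1,5) hor' by (auto simp: visits_def is_horizon_def)
      ultimately have "a = 0"
        using path_node_inject[OF wf *(1) reg', of a 0] by (simp add: stands_def)
      moreover have "precedes (z_node v) j i ?n"
        using not precedes_flip[OF *(4), of "z_node v" ?n] by simp
      then have "a \<noteq> 0"
        using node_later[OF *(2,1) *(4)[symmetric] *(6,5,7) refl *(3)] *(8,9)[unfolded same']
        by blast
      ultimately show False by simp
    qed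
    then show "dep_from f' v' i a \<le> dep_towards v' j b"
      using node_later[OF *(1,2,4,5,6) refl *(7,3)] *(8,9)[unfolded same'] by blast
  qed
  moreover have "initial_conditions R x' f' v'"
    unfolding initial_conditions_def
  proof (intro conjI ballI allI impI; (elim conjE)?)
    fix i assume i: "i \<in> edge_trains R x'"
    then show "dep v' i 0 = 0" by (simp add: dep')
    fix j b assume j: "j \<in> trains R" "b < f' j" "j \<noteq> i" and same: "same_track R x' i 0 j b"
    show "precedes (z_edge v') i j (path_edge R x' i 0)"
    proof (rule ccontr)
      assume "\<not> precedes (z_edge v') i j (path_edge R x' i 0)"
      then have "precedes (z_edge v) j i (path_edge R x' j b)"
        using precedes_flip[OF j(3), of "z_edge v"] same_track_imp_eq[OF same] by (simp add: same')
      with edge_later[of j i b 0] j same i pos' edge_sub have "\<Delta> < dep v i (p i + 0)"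
        by (simp add: same_track_sym)
      with in_transit(1)[OF i] show False by simp
    qed
  next
    fix i assume i: "i \<in> node_trains R x'"
    then show "z_slot v' i (path_node R x' i 0) (the (slot x' i))"
      using p_node[OF i] by (auto simp: same' path_node' node_sub operated_to_node_def)
    fix j b
    assume j: "j \<in> trains R" "j \<noteq> i" "0 < b" "b \<le> f' j" "path_node R x' j b = path_node R x' i 0"
    have "b \<le> full_horizon R x' j" using j hor' by (auto simp: is_horizon_def)
    then have "path_node R x' j b \<noteq> path_node R x' j 0"
      using path_node_inject[OF wf j(1) reg', of b 0] j by simp
    then show "precedes (z_node v') i j (path_node R x' i 0)"
      using i j by (auto simp: node' stands_def)
  qed
  moreover have "\<forall>i \<in> trains R. \<forall>k < f' i. 0 \<le> dep v' i k"
    using later C(1) by (auto simp: dep' less')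
  ultimately have "feasible R x' f'"
    by (auto simp: feasible_def feasible_solution_def)
  moreover have "\<forall>i \<in> trains R. position R x' i + f' i = position R x i + f i"
    using position' p_le by (simp add: f'_def)
  ultimately show ?thesis using reg' hor' pos' by blast
qed

section \<open>Recursive feasibility\<close>

text \<open>The invariant of closed-loop operation.\<close>

definition operable ::
  "('n, 'e, 'l, 'i::linorder) railway \<Rightarrow> ('n, 'l, 'i) state \<Rightarrow> 'i horizon \<Rightarrow> bool" where
  "operable R x f \<longleftrightarrow> regular_state R x \<and> is_horizon R x f \<and> (\<forall>i \<in> edge_trains R x. 0 < f i) \<and>
     (\<forall>n \<in> nodes R. has_room R x f n) \<and> feasible R x f"

lemma operable_extend:
  assumes "wf_railway R" "operable R x f" "is_horizon R x g" "\<And>n. n \<in> nodes R \<Longrightarrow> has_room R x g n"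
    and le: "\<And>i. i \<in> trains R \<Longrightarrow> f i \<le> g i"
  shows "operable R x g"
proof -
  have "0 < g i" if "i \<in> edge_trains R x" for i
    using assms(2) that le[of i] by (force simp: operable_def edge_trains_def)
  moreover have "feasible R x g"
    using assms by (intro feasible_extend[of R x g f]) (auto simp: operable_def)
  ultimately show ?thesis using assms by (simp add: operable_def)
qed

lemma operable_recomputation:
  fixes R :: "('n, 'e, 'l, 'i::linorder) railway"
  assumes wf: "wf_railway R" and \<Delta>: "0 < \<Delta>" and op: "operable R x f"
    and re: "recomputation R \<Delta> (x, f) (x', f')"
  shows "operable R x' f'"
proof -
  from re obtain v where v: "feasible_solution R x f v" "operates_to R x f v \<Delta> x'"
    and f': "is_horizon R x' f'" "safe_terminal_state R x' f'"
    and nr: "\<And>i. i \<in> trains R \<Longrightarrow> position R x i + f i \<le> position R x' i + f' i"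
    by (auto simp: recomputation_def non_regressive_def)
  have "regular_state R x' \<and> (\<exists>h. is_horizon R x' h \<and> feasible R x' h \<and>
    (\<forall>i \<in> trains R. position R x' i + h i = position R x i + f i) \<and>
    (\<forall>i \<in> edge_trains R x'. 0 < h i))"
    using op by (intro feasible_after_operation[OF wf _ _ _ v \<Delta>]) (auto simp: operable_def)
  then obtain h where h: "regular_state R x'" "is_horizon R x' h" "feasible R x' h"
    "\<And>i. i \<in> trains R \<Longrightarrow> position R x' i + h i = position R x i + f i"
    "\<And>i. i \<in> edge_trains R x' \<Longrightarrow> 0 < h i"
    by blast
  have "standing R x' h n = standing R x f n" for n
    using h(4) by (auto simp: standing_def path_node_def)
  then have "operable R x' h"
    using op h by (simp add: operable_def has_room_def)
  moreover have "h i \<le> f' i" if "i \<in> trains R" for i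
    using nr[OF that] h(4)[OF that] by simp
  ultimately show ?thesis
    using operable_extend[OF wf _ f'(1) safe_terminal_state_has_room[OF wf f'(2)]] by blast
qed

theorem theorem1:
  fixes R :: "('n, 'e, 'l, 'i::linorder) railway"
    and x :: "('n, 'l, 'i) state"
    and f :: "'i horizon"
    and previous :: "(('n, 'l, 'i) state \<times> 'i horizon) option"
    and \<Delta> :: real
  assumes "wf_railway R"
    and "admissible R x"
    and "safe_optimization_horizon R x f"
    and "non_regressive R (x, \<lambda>_. 0) (x, f)"
    and "\<And>p. previous = Some p \<Longrightarrow> non_regressive R p (x, f)"
    and "0 < \<Delta>"
  shows "(\<not> deadlocked R x \<longleftrightarrow> feasible R x f) \<and>
         (feasible R x f \<longrightarrow> recursively_feasible R \<Delta> x f)"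
proof -
  note wf = assms(1)
  have reg: "regular_state R x" by (rule admissible_imp_regular_state[OF assms(2)])
  obtain f\<^sub>0 where f\<^sub>0: "is_horizon R x f\<^sub>0"
    "\<And>i. i \<in> trains R \<Longrightarrow> 0 < full_horizon R x i \<Longrightarrow> 1 \<le> f\<^sub>0 i" and ret: "returns R x f\<^sub>0 f"
    using assms(3) by (auto simp: safe_optimization_horizon_def initial_horizon_def)
  note f = returns_facts[OF wf reg ret f\<^sub>0(1)]
  have "0 < f i" if "i \<in> edge_trains R x" for i
  proof -
    have i: "i \<in> trains R" "0 < full_horizon R x i"
      using that assms(2) by (simp_all add: admissible_def edge_trains_def)
    then have "1 \<le> f\<^sub>0 i" by (rule f\<^sub>0(2))
    also have "f\<^sub>0 i \<le> f i" using f i(1) by blast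
    finally show ?thesis by simp
  qed
  with f reg have operable: "operable R x f" if "feasible R x f"
    using that by (simp add: operable_def)
  have full: "is_horizon R x (full_horizon R x)" by (simp add: is_horizon_def)

  have "feasible R x (full_horizon R x)" if "feasible R x f"
  proof -
    have "f i \<le> full_horizon R x i" if "i \<in> trains R" for i
      using f that by (simp add: is_horizon_def)
    then have "operable R x (full_horizon R x)"
      using operable_extend[OF wf operable[OF that] full has_room_full_horizon[OF wf reg]] by blast
    then show ?thesis by (simp add: operable_def)
  qed
  moreover have "feasible R x f" if "feasible R x (full_horizon R x)"
    using f feasible_cong[OF _ that, of f] by metis
  moreover have "recursively_feasible R \<Delta> x f" if "feasible R x f"
    unfolding recursively_feasible_def
  proof (intro allI impI)
    fix x' f' assume "(recomputation R \<Delta>)\<^sup>+\<^sup>+ (x, f) (x', f')"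
    then have "case (x', f') of (x', f') \<Rightarrow> operable R x' f'"
    proof (induction rule: tranclp_induct)
      case (base y)
      then show ?case
        using operable_recomputation[OF wf \<open>0 < \<Delta>\<close> operable[OF that]] by (cases y) auto
    next
      case (step y z)
      then show ?case
        using operable_recomputation[OF wf \<open>0 < \<Delta>\<close>] by (cases y; cases z) auto
    qed
    then show "feasible R x' f'" by (simp add: operable_def)
  qed
  ultimately show ?thesis by (auto simp: deadlocked_def)
qed

end
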